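(* Let $K$ be a field, $S=K[x_1,\dots,x_n]$, and let $I\subset S$ be a Cohen-Macaulay monomial ideal of codimension $2$ with linear resolution. Then $\mathcal{T}(I)=\mathcal{T}(G(I))$; that is, the relation trees of $I$ are exactly the spanning trees of the Taylor graph $G(I)$.
   Context: An ideal $I\subset S$ is Cohen-Macaulay if $S/I$ is Cohen-Macaulay; its codimension is its height. $I$ has a linear resolution if, for some $d$, it is generated in degree $d$ and all the matrices of maps in its minimal graded free resolution have only linear forms (or zero) as entries. Let $I$ be a Cohen-Macaulay monomial ideal of codimension $2$ with unique minimal set of monomial generators $u_1,\dots,u_{m+1}$ (in a fixed labelling). Let $U$ be the kernel of the map $S^{m+1}=\bigoplus_{i=1}^{m+1} Se_i\to S$, $e_i\mapsto u_i$; $U$ is a free $S$-module of rank $m$. For $i<j$ the Taylor relation is $r_{ij}=u_{ji}e_j-u_{ij}e_i\in U$, where $u_{ji}=u_i/\gcd(u_i,u_j)$ and $u_{ij}=u_j/\gcd(u_i,u_j)$. The Taylor relations generate $U$. A Hilbert-Burch matrix of $I$ is an $m\times(m+1)$ matrix whose rows are $m$ Taylor relations forming a minimal system of generators (equivalently a basis) of $U$. To such a matrix one assigns the graph on the vertex set $[m+1]=\{1,\dots,m+1\}$ whose edges are the pairs $\{i,j\}$ for which $r_{ij}$ is a row of the matrix (i.e. there is a row whose nonzero entries are in positions $i$ and $j$); this graph is a tree, called a relation tree of $I$. $\mathcal{T}(I)$ denotes the set of all relation trees of $I$. The Taylor graph $G(I)$ is the graph on $[m+1]$ whose edge set is $\bigcup_{\Gamma\in\mathcal{T}(I)}E(\Gamma)$.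 For a finite simple connected graph $G$, $\mathcal{T}(G)$ denotes the set of all spanning trees of $G$. *)

theory Defs
  imports
    "HOL-Algebra.Algebra"
    "HOL-Library.Poly_Mapping"
    "HOL-Library.Function_Algebras"
    "HOL-Library.Extended_Nat"
begin

section \<open>Cohen-Macaulay rings, height\<close>

text \<open>\<open>fraction R P a s\<close> is the class of \<open>a/s\<close> in the localization of the commutative ring \<open>R\<close>
  at the complement of the prime ideal \<open>P\<close>.\<close>

definition fraction :: "('a, 'b) ring_scheme \<Rightarrow> 'a set \<Rightarrow> 'a \<Rightarrow> 'a \<Rightarrow> ('a \<times> 'a) set" where
  "fraction R P a s =
     {(b, t). b \<in> carrier R \<and> t \<in> carrier R - P \<and>
        (\<exists>w \<in> carrier R - P. w \<otimes>\<^bsub>R\<^esub> (a \<otimes>\<^bsub>R\<^esub> t) = w \<otimes>\<^bsub>R\<^esub> (b \<otimes>\<^bsub>R\<^esub> s))}"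

definition localization :: "('a, 'b) ring_scheme \<Rightarrow> 'a set \<Rightarrow> ('a \<times> 'a) set ring" where
  "localization R P = \<lparr>
     carrier = {fraction R P a s | a s. a \<in> carrier R \<and> s \<in> carrier R - P},
     monoid.mult = (\<lambda>U V. \<Union>(a, s)\<in>U. \<Union>(b, t)\<in>V. fraction R P (a \<otimes>\<^bsub>R\<^esub> b) (s \<otimes>\<^bsub>R\<^esub> t)),
     one = fraction R P \<one>\<^bsub>R\<^esub> \<one>\<^bsub>R\<^esub>,
     ring.zero = fraction R P \<zero>\<^bsub>R\<^esub> \<one>\<^bsub>R\<^esub>,
     add = (\<lambda>U V. \<Union>(a, s)\<in>U. \<Union>(b, t)\<in>V.
              fraction R P ((a \<otimes>\<^bsub>R\<^esub> t) \<oplus>\<^bsub>R\<^esub> (b \<otimes>\<^bsub>R\<^esub> s)) (s \<otimes>\<^bsub>R\<^esub> t)) \<rparr>"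

definition prime_chain :: "('a, 'b) ring_scheme \<Rightarrow> (nat \<Rightarrow> 'a set) \<Rightarrow> nat \<Rightarrow> bool" where
  "prime_chain R c k \<longleftrightarrow> (\<forall>i\<le>k. primeideal (c i) R) \<and> (\<forall>i<k. c i \<subset> c (Suc i))"

definition krull_dim :: "('a, 'b) ring_scheme \<Rightarrow> enat" where
  "krull_dim R = Sup {enat k | k. \<exists>c. prime_chain R c k}"

definition prime_height :: "('a, 'b) ring_scheme \<Rightarrow> 'a set \<Rightarrow> enat" where
  "prime_height R P = Sup {enat k | k. \<exists>c. prime_chain R c k \<and> c k = P}"

definition height :: "('a, 'b) ring_scheme \<Rightarrow> 'a set \<Rightarrow> enat" where
  "height R I = Inf {prime_height R P | P. primeideal P R \<and> I \<subseteq> P}"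

definition regular_sequence :: "('a, 'b) ring_scheme \<Rightarrow> 'a list \<Rightarrow> bool" where
  "regular_sequence R xs \<longleftrightarrow>
     set xs \<subseteq> carrier R \<and> genideal R (set xs) \<noteq> carrier R \<and>
     (\<forall>i<length xs. \<forall>y\<in>carrier R.
        xs ! i \<otimes>\<^bsub>R\<^esub> y \<in> genideal R (set (take i xs)) \<longrightarrow> y \<in> genideal R (set (take i xs)))"

text \<open>Only meant for local rings, whose maximal ideal is the set of non-units.\<close>

definition local_depth :: "('a, 'b) ring_scheme \<Rightarrow> enat" where
  "local_depth R =
     Sup {enat (length xs) | xs. regular_sequence R xs \<and> set xs \<subseteq> carrier R - Units R}"

definition cohen_macaulay_ring :: "('a, 'b) ring_scheme \<Rightarrow> bool" where
  "cohen_macaulay_ring R \<longleftrightarrow> cring R \<and> noetherian_ring R \<and>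
     (\<forall>M. maximalideal M R \<longrightarrow>
        local_depth (localization R M) = krull_dim (localization R M))"


section \<open>Polynomial rings and monomial ideals\<close>

text \<open>The polynomial ring with coefficients in \<open>'k\<close> and one variable for each element of \<open>'n\<close>;
  a monomial is represented by its exponent vector, of type \<open>'n \<Rightarrow>\<^sub>0 nat\<close>.\<close>

type_synonym ('n, 'k) mpoly = "('n \<Rightarrow>\<^sub>0 nat) \<Rightarrow>\<^sub>0 'k"

definition mpoly_ring :: "('n, 'k::field) mpoly ring" where
  "mpoly_ring = \<lparr> carrier = UNIV, monoid.mult = (*), one = 1, ring.zero = 0, add = (+) \<rparr>"

definition monomial :: "('n \<Rightarrow>\<^sub>0 nat) \<Rightarrow> ('n, 'k::field) mpoly" where
  "monomial t = Poly_Mapping.single t 1"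

definition mono_gcd :: "('n::finite \<Rightarrow>\<^sub>0 nat) \<Rightarrow> ('n \<Rightarrow>\<^sub>0 nat) \<Rightarrow> ('n \<Rightarrow>\<^sub>0 nat)" where
  "mono_gcd s t = Abs_poly_mapping (\<lambda>x. min (Poly_Mapping.lookup s x) (Poly_Mapping.lookup t x))"

definition mono_deg :: "('n::finite \<Rightarrow>\<^sub>0 nat) \<Rightarrow> nat" where
  "mono_deg t = (\<Sum>x\<in>UNIV. Poly_Mapping.lookup t x)"

definition homogeneous :: "nat \<Rightarrow> ('n::finite, 'k::field) mpoly \<Rightarrow> bool" where
  "homogeneous d f \<longleftrightarrow> (\<forall>t\<in>Poly_Mapping.keys f. mono_deg t = d)"

definition monomial_ideal :: "('n, 'k::field) mpoly set \<Rightarrow> bool" where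
  "monomial_ideal I \<longleftrightarrow> (\<exists>T. I = genideal mpoly_ring (monomial ` T))"

definition minimal_monomial_generators ::
  "('n, 'k::field) mpoly set \<Rightarrow> ('n \<Rightarrow>\<^sub>0 nat) set \<Rightarrow> bool" where
  "minimal_monomial_generators I T \<longleftrightarrow>
     I = genideal mpoly_ring (monomial ` T) \<and> (\<forall>T'. T' \<subset> T \<longrightarrow> genideal mpoly_ring (monomial ` T') \<noteq> I)"


section \<open>Free modules and linear resolutions\<close>

text \<open>The free module with basis indexed by \<open>A\<close>: vectors vanishing outside \<open>A\<close>.\<close>

definition free_mod :: "nat set \<Rightarrow> (nat \<Rightarrow> ('n, 'k::field) mpoly) set" where
  "free_mod A = {v. \<forall>i. i \<notin> A \<longrightarrow> v i = 0}"

definition vec_scale ::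
  "('n, 'k::field) mpoly \<Rightarrow> (nat \<Rightarrow> ('n, 'k) mpoly) \<Rightarrow> nat \<Rightarrow> ('n, 'k) mpoly" where
  "vec_scale c v = (\<lambda>i. c * v i)"

global_interpretation vec: Modules.module vec_scale
  by unfold_locales (auto simp: vec_scale_def fun_eq_iff algebra_simps)

definition mat_vec ::
  "nat \<Rightarrow> nat \<Rightarrow> (nat \<Rightarrow> nat \<Rightarrow> ('n, 'k::field) mpoly) \<Rightarrow>
   (nat \<Rightarrow> ('n, 'k) mpoly) \<Rightarrow> nat \<Rightarrow> ('n, 'k) mpoly" where
  "mat_vec p q M v = (\<lambda>i. if i < p then \<Sum>j<q. M i j * v j else 0)"

text \<open>A minimal graded free resolution of \<open>I\<close>. The \<open>i\<close>-th free module \<open>F\<^sub>i\<close> has rank \<open>b i\<close> and its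
  \<open>j\<close>-th basis element has degree \<open>a i j\<close>. The augmentation from \<open>F\<^sub>0\<close> onto \<open>I\<close> sends the \<open>j\<close>-th
  basis element to \<open>g j\<close>, and \<open>\<phi> i\<close> is the \<open>b i \<times> b (i + 1)\<close> matrix of the map from \<open>F\<^sub>i\<^sub>+\<^sub>1\<close> to
  \<open>F\<^sub>i\<close>. The last clause says that the image of each such map lies in
  \<open>(x\<^sub>1, \<dots>, x\<^sub>n) F\<^sub>i\<close>, i.e. that no entry has a constant term.\<close>

definition minimal_graded_free_resolution ::
  "('n::finite, 'k::field) mpoly set \<Rightarrow> (nat \<Rightarrow> nat) \<Rightarrow> (nat \<Rightarrow> nat \<Rightarrow> nat) \<Rightarrow>
   (nat \<Rightarrow> ('n, 'k) mpoly) \<Rightarrow> (nat \<Rightarrow> nat \<Rightarrow> nat \<Rightarrow> ('n, 'k) mpoly) \<Rightarrow> bool" where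
  "minimal_graded_free_resolution I b a g \<phi> \<longleftrightarrow>
     (\<forall>j<b 0. homogeneous (a 0 j) (g j)) \<and>
     (\<forall>i. \<forall>p<b i. \<forall>q<b (i + 1). \<forall>t\<in>Poly_Mapping.keys (\<phi> i p q). mono_deg t + a i p = a (i + 1) q) \<and>
     {\<Sum>j<b 0. v j * g j | v. v \<in> free_mod {..<b 0}} = I \<and>
     {v \<in> free_mod {..<b 0}. (\<Sum>j<b 0. v j * g j) = 0} =
       mat_vec (b 0) (b 1) (\<phi> 0) ` free_mod {..<b 1} \<and>
     (\<forall>i. {v \<in> free_mod {..<b (i + 1)}. mat_vec (b i) (b (i + 1)) (\<phi> i) v = 0} =
            mat_vec (b (i + 1)) (b (i + 2)) (\<phi> (i + 1)) ` free_mod {..<b (i + 2)}) \<and>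
     (\<forall>i. \<forall>p<b i. \<forall>q<b (i + 1). Poly_Mapping.lookup (\<phi> i p q) 0 = 0)"

definition has_linear_resolution :: "('n::finite, 'k::field) mpoly set \<Rightarrow> bool" where
  "has_linear_resolution I \<longleftrightarrow>
     (\<exists>d. (\<exists>F. (\<forall>f\<in>F. homogeneous d f) \<and> I = genideal mpoly_ring F) \<and>
        (\<exists>b a g \<phi>. minimal_graded_free_resolution I b a g \<phi> \<and>
           (\<forall>i. \<forall>p<b i. \<forall>q<b (i + 1). homogeneous 1 (\<phi> i p q))))"


section \<open>Graphs\<close>

text \<open>A simple graph is a pair of its vertex set and its set of edges (two-element vertex sets).\<close>

type_synonym graph = "nat set \<times> nat set set"

definition simple_graph :: "graph \<Rightarrow> bool" where
  "simple_graph G \<longleftrightarrow> finite (fst G) \<and> (\<forall>e\<in>snd G. e \<subseteq> fst G \<and> card e = 2)"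

definition graph_connected :: "graph \<Rightarrow> bool" where
  "graph_connected G \<longleftrightarrow>
     fst G \<noteq> {} \<and> (\<forall>x\<in>fst G. \<forall>y\<in>fst G. (x, y) \<in> {(v, w). {v, w} \<in> snd G}\<^sup>*)"

definition graph_cycle :: "graph \<Rightarrow> nat list \<Rightarrow> bool" where
  "graph_cycle G vs \<longleftrightarrow> 3 \<le> length vs \<and> distinct vs \<and>
     (\<forall>i. Suc i < length vs \<longrightarrow> {vs ! i, vs ! Suc i} \<in> snd G) \<and> {last vs, hd vs} \<in> snd G"

definition is_tree :: "graph \<Rightarrow> bool" where
  "is_tree G \<longleftrightarrow> simple_graph G \<and> graph_connected G \<and> (\<nexists>vs. graph_cycle G vs)"

definition spanning_trees :: "graph \<Rightarrow> graph set" where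
  "spanning_trees G = {H. is_tree H \<and> fst H = fst G \<and> snd H \<subseteq> snd G}"


section \<open>Relation trees and the Taylor graph\<close>

text \<open>In the following, \<open>u i\<close> for \<open>i \<in> {1..m+1}\<close> are (the exponent vectors of) the minimal monomial
  generators of the ideal. The exponent vector of \<open>u\<^sub>i / gcd(u\<^sub>i, u\<^sub>j)\<close> is
  \<open>u i - mono_gcd (u i) (u j)\<close>.\<close>

definition relation_module ::
  "nat \<Rightarrow> (nat \<Rightarrow> 'n \<Rightarrow>\<^sub>0 nat) \<Rightarrow> (nat \<Rightarrow> ('n, 'k::field) mpoly) set" where
  "relation_module m u = {v \<in> free_mod {1..m+1}. (\<Sum>i=1..m+1. v i * monomial (u i)) = 0}"

definition taylor_relation ::
  "(nat \<Rightarrow> 'n::finite \<Rightarrow>\<^sub>0 nat) \<Rightarrow> nat \<Rightarrow> nat \<Rightarrow> nat \<Rightarrow> ('n, 'k::field) mpoly" where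
  "taylor_relation u i j =
     (\<lambda>k. if k = j then monomial (u i - mono_gcd (u i) (u j))
          else if k = i then - monomial (u j - mono_gcd (u i) (u j))
          else 0)"

text \<open>\<open>A\<close> is given by its rows \<open>A p\<close> for \<open>p \<in> {1..m}\<close>.\<close>

definition hilbert_burch_matrix ::
  "nat \<Rightarrow> (nat \<Rightarrow> 'n::finite \<Rightarrow>\<^sub>0 nat) \<Rightarrow> (nat \<Rightarrow> nat \<Rightarrow> ('n, 'k::field) mpoly) \<Rightarrow> bool" where
  "hilbert_burch_matrix m u A \<longleftrightarrow>
     (\<forall>p\<in>{1..m}. \<exists>i j. 1 \<le> i \<and> i < j \<and> j \<le> m + 1 \<and> A p = taylor_relation u i j) \<and>
     vec.span (A ` {1..m}) = relation_module m u \<and>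
     (\<forall>p\<in>{1..m}. vec.span (A ` ({1..m} - {p})) \<noteq> relation_module m u)"

definition matrix_graph ::
  "nat \<Rightarrow> (nat \<Rightarrow> 'n::finite \<Rightarrow>\<^sub>0 nat) \<Rightarrow> (nat \<Rightarrow> nat \<Rightarrow> ('n, 'k::field) mpoly) \<Rightarrow> graph" where
  "matrix_graph m u A =
     ({1..m+1},
      {{i, j} | i j. 1 \<le> i \<and> i < j \<and> j \<le> m + 1 \<and> (\<exists>p\<in>{1..m}. A p = taylor_relation u i j)})"

text \<open>The coefficient field \<open>'k\<close> does not occur in \<open>u\<close>, hence the type argument.\<close>

definition relation_trees ::
  "'k::field itself \<Rightarrow> nat \<Rightarrow> (nat \<Rightarrow> 'n::finite \<Rightarrow>\<^sub>0 nat) \<Rightarrow> graph set" where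
  "relation_trees K m u =
     {matrix_graph m u A | A :: nat \<Rightarrow> nat \<Rightarrow> ('n, 'k) mpoly. hilbert_burch_matrix m u A}"

definition taylor_graph ::
  "'k::field itself \<Rightarrow> nat \<Rightarrow> (nat \<Rightarrow> 'n::finite \<Rightarrow>\<^sub>0 nat) \<Rightarrow> graph" where
  "taylor_graph K m u = ({1..m+1}, \<Union>\<Gamma>\<in>relation_trees K m u. snd \<Gamma>)"

end

theory Submission
  imports Defs "HOL-Library.Transitive_Closure_Table"
begin

text \<open>
  Let \<open>u\<^sub>1, \<dots>, u\<^sub>m\<^sub>+\<^sub>1\<close> be the minimal generators and \<open>U\<close> their relation module. The linear
  resolution enters through two facts (\<open>linear_resolution_linear_syzygies\<close>): all \<open>u\<^sub>i\<close> have the same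
  degree, and \<open>U\<close> is generated by the \<open>K\<close>-space \<open>U\<^sub>1\<close> of those relations whose entries are linear
  forms. Every Taylor relation is homogeneous, so comparing linear parts shows that \<open>U\<^sub>1\<close> is spanned
  over \<open>K\<close> by the linear rows of any Hilbert-Burch matrix; these rows therefore already generate \<open>U\<close>,
  and by minimality there are no others (\<open>hilbert_burch_linear\<close>). Hence, as soon as one
  Hilbert-Burch matrix exists, \<open>U\<^sub>1\<close> has dimension at most \<open>m\<close>, and whether \<open>m\<close> linear Taylor
  relations generate \<open>U\<close> becomes a question of linear algebra over \<open>K\<close>.

  The link to graphs is a family of functionals, one for each set \<open>C\<close> of vertices: the map
  \<open>v \<mapsto> \<Sum>k\<in>C. v\<^sub>k u\<^sub>k\<close> kills the Taylor relation \<open>r\<^sub>i\<^sub>j\<close> if \<open>C\<close> does not separate \<open>i\<close> from \<open>j\<close>, and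
  sends it to \<open>\<plusminus> lcm(u\<^sub>i, u\<^sub>j)\<close> otherwise. So \<open>r\<^sub>i\<^sub>j\<close> lies in the submodule generated by the relations
  of the edges of a graph only if the graph connects \<open>i\<close> with \<open>j\<close>
  (\<open>connected_if_taylor_relation_in_span\<close>).

  Applied to the rows of a Hilbert-Burch matrix, this makes their graph connected; as it has \<open>m + 1\<close>
  vertices and at most \<open>m\<close> edges, it is a tree, and its edges are edges of the Taylor graph by
  definition. Conversely, let \<open>\<Gamma>\<close> be a spanning tree of the Taylor graph. Each edge of \<open>\<Gamma>\<close> comes from
  a row of some Hilbert-Burch matrix, so its relation lies in \<open>U\<^sub>1\<close>. Each edge of a tree is a bridge,
  so no relation of \<open>\<Gamma>\<close> lies in the submodule generated by the other ones. In particular the \<open>m\<close>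
  relations of \<open>\<Gamma>\<close> are linearly independent over \<open>K\<close>, hence span \<open>U\<^sub>1\<close>, hence generate \<open>U\<close>, and they
  do so minimally (\<open>hilbert_burch_of_tree\<close>).
\<close>

section \<open>Homogeneous parts of polynomials\<close>

lemma mono_deg_add: "mono_deg (s + t) = mono_deg s + mono_deg t"
  by (simp add: mono_deg_def lookup_add sum.distrib)

lemma mono_deg_eq_0_iff: "mono_deg t = 0 \<longleftrightarrow> t = 0"
  by (auto simp: mono_deg_def poly_mapping_eq_iff fun_eq_iff)

lemma monomial_mult: "monomial s * monomial t = monomial (s + t)"
  by (simp add: monomial_def mult_single)

lemma monomial_nonzero: "monomial t \<noteq> 0"
  by (metis lookup_single_eq lookup_zero monomial_def zero_neq_one)

lemma homogeneous_0: "homogeneous e 0"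
  by (simp add: homogeneous_def)

lemma homogeneous_monomial_iff: "homogeneous e (monomial t) \<longleftrightarrow> mono_deg t = e"
  by (simp add: homogeneous_def monomial_def)

lemma homogeneous_uminus_iff: "homogeneous e (- f) \<longleftrightarrow> homogeneous e f"
  by (simp add: homogeneous_def)

lemma homogeneous_add:
  assumes "homogeneous e f" "homogeneous e g"
  shows "homogeneous e (f + g)"
  using assms keys_add[of f g] by (auto simp: homogeneous_def)

lemma homogeneous_sum:
  assumes "\<And>x. x \<in> A \<Longrightarrow> homogeneous e (f x)"
  shows "homogeneous e (\<Sum>x\<in>A. f x)"
  using assms
  by (induction A rule: infinite_finite_induct) (auto simp: homogeneous_0 homogeneous_add)

lemma homogeneous_mult:
  assumes "homogeneous i f" "homogeneous j g"
  shows "homogeneous (i + j) (f * g)"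
  using assms keys_mult[of f g] by (fastforce simp: homogeneous_def mono_deg_add)

lemma homogeneous_degree_0: "homogeneous 0 f \<longleftrightarrow> f = Poly_Mapping.single 0 (Poly_Mapping.lookup f 0)"
proof
  assume "homogeneous 0 f"
  then have "Poly_Mapping.lookup f t = 0" if "t \<noteq> 0" for t
    using that by (auto simp: homogeneous_def mono_deg_eq_0_iff in_keys_iff)
  then show "f = Poly_Mapping.single 0 (Poly_Mapping.lookup f 0)"
    by (intro poly_mapping_eqI) (metis lookup_single_eq lookup_single_not_eq)
next
  assume "f = Poly_Mapping.single 0 (Poly_Mapping.lookup f 0)"
  then have "Poly_Mapping.keys f \<subseteq> {0}"
    by (metis keys_single empty_subsetI order_refl)
  then show "homogeneous 0 f"
    by (auto simp: homogeneous_def mono_deg_eq_0_iff)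
qed

definition hom_part :: "nat \<Rightarrow> ('n::finite, 'k::field) mpoly \<Rightarrow> ('n, 'k) mpoly" where
  "hom_part e f =
     (\<Sum>t\<in>{t \<in> Poly_Mapping.keys f. mono_deg t = e}. Poly_Mapping.single t (Poly_Mapping.lookup f t))"

lemma lookup_hom_part:
  "Poly_Mapping.lookup (hom_part e f) t = (if mono_deg t = e then Poly_Mapping.lookup f t else 0)"
proof -
  have "Poly_Mapping.lookup (hom_part e f) t =
      (\<Sum>s\<in>{s \<in> Poly_Mapping.keys f. mono_deg s = e}. if s = t then Poly_Mapping.lookup f s else 0)"
    unfolding hom_part_def lookup_sum by (intro sum.cong) (auto simp: lookup_single when_def)
  also have "\<dots> = (if mono_deg t = e then Poly_Mapping.lookup f t else 0)"
    by (subst sum.delta) (auto simp: in_keys_iff)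
  finally show ?thesis .
qed

lemma homogeneous_hom_part: "homogeneous e (hom_part e f)"
  by (auto simp: homogeneous_def in_keys_iff lookup_hom_part split: if_splits)

lemma hom_part_0 [simp]: "hom_part e 0 = 0"
  by (intro poly_mapping_eqI) (simp add: lookup_hom_part)

lemma hom_part_add: "hom_part e (f + g) = hom_part e f + hom_part e g"
  by (intro poly_mapping_eqI) (simp add: lookup_hom_part lookup_add)

lemma hom_part_sum: "hom_part e (\<Sum>x\<in>A. f x) = (\<Sum>x\<in>A. hom_part e (f x))"
  by (induction A rule: infinite_finite_induct) (auto simp: hom_part_add)

lemma hom_part_homogeneous:
  assumes "homogeneous k f"
  shows "hom_part e f = (if e = k then f else 0)"
  using assms by (intro poly_mapping_eqI) (auto simp: lookup_hom_part homogeneous_def in_keys_iff)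

text \<open>Multiplication by a form of degree \<open>k\<close> shifts degrees by \<open>k\<close>. This is the tool for comparing
  homogeneous parts on both sides of an identity with arbitrary polynomial coefficients.\<close>

lemma hom_part_mult:
  assumes g: "homogeneous k g"
  shows "hom_part e (f * g) = (if k \<le> e then hom_part (e - k) f * g else 0)"
proof (induction f rule: update_induct)
  case const
  show ?case by simp
next
  case (update f t b)
  have split: "Poly_Mapping.update t b f = Poly_Mapping.single t b + f"
    using update.hyps(1)
    by (intro poly_mapping_eqI)
      (auto simp: lookup_update lookup_add lookup_single when_def in_keys_iff)
  have single: "homogeneous (mono_deg t) (Poly_Mapping.single t b)"
    by (simp add: homogeneous_def)
  have "hom_part e (Poly_Mapping.single t b * g) =
      (if k \<le> e then hom_part (e - k) (Poly_Mapping.single t b) * g else 0)"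
    by (auto simp: hom_part_homogeneous[OF homogeneous_mult[OF single g]] hom_part_homogeneous[OF single])
  then show ?case
    using update.IH by (simp add: split distrib_right hom_part_add)
qed


section \<open>Ideals as submodules of the polynomial ring\<close>

interpretation ring_mod: Modules.module "(*) :: 'a::comm_ring_1 \<Rightarrow> 'a \<Rightarrow> 'a"
  by unfold_locales (auto simp: algebra_simps)

\<comment> \<open>As a rewrite rule this is associativity in the direction opposite to \<open>mult.assoc\<close>.\<close>
declare ring_mod.scale_scale [simp del]

lemma ring_mpoly_ring: "ring (mpoly_ring :: ('n, 'k::field) mpoly ring)"
proof (rule ringI)
  show "abelian_group (mpoly_ring :: ('n, 'k) mpoly ring)"
  proof (rule abelian_groupI)
    fix x :: "('n, 'k) mpoly"
    show "\<exists>y\<in>carrier mpoly_ring. y \<oplus>\<^bsub>mpoly_ring\<^esub> x = \<zero>\<^bsub>mpoly_ring\<^esub>"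
      by (rule bexI[of _ "- x"]) (auto simp: mpoly_ring_def)
  qed (simp_all add: mpoly_ring_def add.assoc add.commute)
  show "monoid (mpoly_ring :: ('n, 'k) mpoly ring)"
    by (rule monoidI) (simp_all add: mpoly_ring_def mult.assoc)
qed (simp_all add: mpoly_ring_def distrib_left distrib_right)

lemma a_inv_mpoly_ring: "\<ominus>\<^bsub>mpoly_ring\<^esub> x = - x"
proof -
  interpret R: ring "mpoly_ring :: ('a, 'b) mpoly ring" by (rule ring_mpoly_ring)
  have "x \<oplus>\<^bsub>mpoly_ring\<^esub> (- x) = \<zero>\<^bsub>mpoly_ring\<^esub>" "x \<in> carrier mpoly_ring" "- x \<in> carrier mpoly_ring"
    by (auto simp: mpoly_ring_def)
  then show ?thesis using R.minus_equality R.a_comm by metis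
qed

lemma ideal_mpoly_ring_iff:
  "ideal (J :: ('n, 'k::field) mpoly set) mpoly_ring \<longleftrightarrow> ring_mod.subspace J"
proof
  assume "ideal J mpoly_ring"
  then interpret ideal J "mpoly_ring :: ('n, 'k) mpoly ring" .
  show "ring_mod.subspace J"
    using additive_subgroup.zero_closed[OF is_additive_subgroup]
      additive_subgroup.a_closed[OF is_additive_subgroup] I_l_closed
    by (simp add: ring_mod.subspace_def mpoly_ring_def)
next
  assume J: "ring_mod.subspace J"
  have "subgroup J (add_monoid mpoly_ring)"
  proof (rule group.subgroupI)
    show "Group.group (add_monoid (mpoly_ring :: ('n, 'k) mpoly ring))"
      using ring_mpoly_ring[where 'n='n and 'k='k] by (simp add: ring_def abelian_group_def abelian_group_axioms_def comm_group_def)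
    show "J \<noteq> {}" using ring_mod.subspace_0[OF J] by auto
    show "inv\<^bsub>add_monoid mpoly_ring\<^esub> a \<in> J" if "a \<in> J" for a
      using ring_mod.subspace_neg[OF J that] a_inv_mpoly_ring[of a] by (simp add: a_inv_def)
  qed (use ring_mod.subspace_add[OF J] in \<open>auto simp: mpoly_ring_def\<close>)
  then show "ideal J mpoly_ring"
    by (rule idealI[OF ring_mpoly_ring])
      (use ring_mod.subspace_scale[OF J] in \<open>auto simp: mpoly_ring_def mult.commute\<close>)
qed

text \<open>Ideals are the submodules of the ring, so membership in a generated ideal can be handled with
  the induction rules and monotonicity of spans.\<close>

lemma genideal_eq_span: "genideal mpoly_ring F = ring_mod.span (F :: ('n, 'k::field) mpoly set)"
  by (simp add: genideal_def ideal_mpoly_ring_iff ring_mod.span_def hull_def)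

lemma span_image_eq:
  fixes f :: "'a \<Rightarrow> 'b::comm_ring_1"
  assumes "finite A" "y \<in> ring_mod.span (f ` A)"
  obtains c where "y = (\<Sum>x\<in>A. c x * f x)"
proof -
  have "\<exists>c. y = (\<Sum>x\<in>A. c x * f x)"
    using assms(2)
  proof (induction rule: ring_mod.span_induct_alt)
    case base
    then show ?case by (intro exI[of _ "\<lambda>_. 0"]) simp
  next
    case (step a z y)
    then obtain x c where x: "x \<in> A" "z = f x" "y = (\<Sum>x\<in>A. c x * f x)" by blast
    have "a * z + y = (\<Sum>w\<in>A. (c w + (if w = x then a else 0)) * f w)"
      using x assms(1) by (simp add: distrib_right sum.distrib if_distrib[of "\<lambda>c. c * _"] cong: if_cong)
    then show ?case by (rule exI[of _ "\<lambda>w. c w + (if w = x then a else 0)"])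
  qed
  then show ?thesis using that by blast
qed


section \<open>Trees\<close>

text \<open>Fix a root and send every other vertex to the last edge of a shortest path from the root. This
  is injective: if two vertices shared that edge, each would be closer to the root than the other.\<close>

lemma card_vertices_le:
  assumes G: "simple_graph G" "graph_connected G"
  shows "card (fst G) \<le> Suc (card (snd G))"
proof -
  define R where "R = {(v, w). {v, w} \<in> snd G}"
  obtain r where r: "r \<in> fst G" using G(2) by (auto simp: graph_connected_def)
  define dist where "dist v = (LEAST k. (r, v) \<in> R ^^ k)" for v
  have "\<exists>w. (w, v) \<in> R \<and> dist v = Suc (dist w)" if v: "v \<in> fst G - {r}" for v
  proof -
    have ex: "\<exists>k. (r, v) \<in> R ^^ k"
      using G(2) r v rtrancl_imp_relpow[of "(r, v)" R] by (auto simp: graph_connected_def R_def[symmetric])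
    have dv: "(r, v) \<in> R ^^ dist v" unfolding dist_def by (rule LeastI_ex[OF ex])
    have "dist v \<noteq> 0" using dv v by (intro notI) auto
    then obtain k where k: "dist v = Suc k" by (cases "dist v") auto
    with dv obtain w where w: "(r, w) \<in> R ^^ k" "(w, v) \<in> R" by auto
    have "(r, w) \<in> R ^^ dist w" unfolding dist_def using w(1) by (rule LeastI)
    then have "(r, v) \<in> R ^^ Suc (dist w)" using w(2) by auto
    then have "dist v \<le> Suc (dist w)" unfolding dist_def[of v] by (rule Least_le)
    moreover have "dist w \<le> k" unfolding dist_def using w(1) by (rule Least_le)
    ultimately show ?thesis using k w(2) by auto
  qed
  then obtain p where p: "\<And>v. v \<in> fst G - {r} \<Longrightarrow> (p v, v) \<in> R \<and> dist v = Suc (dist (p v))"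
    by metis
  have "inj_on (\<lambda>v. {p v, v}) (fst G - {r})"
  proof (rule inj_onI)
    fix v w assume v: "v \<in> fst G - {r}" and w: "w \<in> fst G - {r}" and eq: "{p v, v} = {p w, w}"
    show "v = w"
    proof (rule ccontr)
      assume "v \<noteq> w"
      with eq have "p v = w" "p w = v" by (auto simp: doubleton_eq_iff)
      then show False using p[OF v] p[OF w] by auto
    qed
  qed
  moreover have "(\<lambda>v. {p v, v}) ` (fst G - {r}) \<subseteq> snd G" using p by (auto simp: R_def)
  moreover have "finite (snd G)"
    using G(1) by (intro finite_subset[of "snd G" "Pow (fst G)"]) (auto simp: simple_graph_def)
  ultimately have "card (fst G - {r}) \<le> card (snd G)" by (rule card_inj_on_le)
  then show ?thesis using r by simp
qed

text \<open>An edge on a cycle can be removed without disconnecting the graph, which would leave fewer edges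
  than a connected graph needs.\<close>

lemma is_treeI_card:
  assumes G: "simple_graph G" "graph_connected G" and card: "card (snd G) < card (fst G)"
  shows "is_tree G"
proof -
  have False if cyc: "graph_cycle G vs" for vs
  proof -
    from cyc have len: "3 \<le> length vs" and dist: "distinct vs"
      and steps: "\<And>i. Suc i < length vs \<Longrightarrow> {vs ! i, vs ! Suc i} \<in> snd G"
      and closing: "{last vs, hd vs} \<in> snd G" by (auto simp: graph_cycle_def)
    \<comment> \<open>The closing edge of the cycle is removed; the rest of the cycle is a detour around it.\<close>
    define E where "E = snd G - {{last vs, hd vs}}"
    define R where "R = {(v, w). {v, w} \<in> E}"
    have sym: "sym R" by (auto simp: R_def sym_def insert_commute)
    have ends: "hd vs = vs ! 0" "last vs = vs ! (length vs - 1)"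
      using len hd_conv_nth[of vs] last_conv_nth[of vs] by fastforce+
    have "(vs ! 0, vs ! i) \<in> R\<^sup>*" if "i < length vs" for i
      using that
    proof (induction i)
      case (Suc i)
      \<comment> \<open>Length at least 3 is what keeps the closing edge apart from the other edges of the cycle.\<close>
      have "{vs ! i, vs ! Suc i} \<noteq> {last vs, hd vs}"
      proof
        assume "{vs ! i, vs ! Suc i} = {last vs, hd vs}"
        then have "vs ! i = vs ! (length vs - 1) \<and> vs ! Suc i = vs ! 0 \<or>
            vs ! i = vs ! 0 \<and> vs ! Suc i = vs ! (length vs - 1)"
          unfolding ends doubleton_eq_iff .
        moreover have "0 < length vs" "length vs - 1 < length vs" "i < length vs"
          using Suc.prems len by linarith+
        ultimately have "i = length vs - 1 \<and> Suc i = 0 \<or> i = 0 \<and> Suc i = length vs - 1"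
          using Suc.prems nth_eq_iff_index_eq[OF dist] by metis
        then show False using len by linarith
      qed
      then have "(vs ! i, vs ! Suc i) \<in> R" using steps[OF Suc.prems] by (auto simp: R_def E_def)
      with Suc show ?case by (auto intro: rtrancl_into_rtrancl)
    qed auto
    then have detour: "(hd vs, last vs) \<in> R\<^sup>*" using len by (simp add: ends)
    then have detour': "(last vs, hd vs) \<in> R\<^sup>*" using sym_rtrancl[OF sym] by (auto dest: symD)
    have "{(v, w). {v, w} \<in> snd G} \<subseteq> R\<^sup>*"
      using detour detour' by (auto simp: R_def E_def doubleton_eq_iff)
    then have "{(v, w). {v, w} \<in> snd G}\<^sup>* \<subseteq> R\<^sup>*" by (metis rtrancl_subset_rtrancl)
    then have "graph_connected (fst G, E)"
      using G(2) by (auto simp: graph_connected_def R_def)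
    moreover have "simple_graph (fst G, E)" using G(1) by (auto simp: simple_graph_def E_def)
    ultimately have "card (fst G) \<le> Suc (card E)" using card_vertices_le by fastforce
    moreover have "finite (snd G)"
      using G(1) by (intro finite_subset[of "snd G" "Pow (fst G)"]) (auto simp: simple_graph_def)
    then have "Suc (card E) = card (snd G)" unfolding E_def using closing by (rule card_Suc_Diff1)
    ultimately show False using card by simp
  qed
  then show ?thesis using G by (auto simp: is_tree_def)
qed

text \<open>A path that joins the endpoints of an edge while avoiding this edge closes up to a cycle.\<close>

lemma tree_edge_is_bridge:
  assumes G: "is_tree G" and edge: "{i, j} \<in> snd G" "i \<noteq> j"
  shows "(i, j) \<notin> {(v, w). {v, w} \<in> snd G - {{i, j}}}\<^sup>*"
proof
  define Q where "Q v w \<longleftrightarrow> {v, w} \<in> snd G - {{i, j}}" for v w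
  assume "(i, j) \<in> {(v, w). {v, w} \<in> snd G - {{i, j}}}\<^sup>*"
  moreover have "{(v, w). {v, w} \<in> snd G - {{i, j}}} = {(v, w). Q v w}" by (simp add: Q_def)
  ultimately have "Q\<^sup>*\<^sup>* i j" by (metis Enum.rtranclp_rtrancl_eq)
  then obtain xs where "rtrancl_path Q i xs j"
    by (auto simp: rtranclp_eq_rtrancl_path)
  then obtain ys where ys: "rtrancl_path Q i ys j" "distinct (i # ys)"
    by (rule rtrancl_path_distinct)
  have ne: "ys \<noteq> []" using ys(1) edge(2) by (auto elim: rtrancl_path.cases)
  have last: "last ys = j" by (rule rtrancl_path_last[OF ys(1) ne])
  have step: "Q ((i # ys) ! k) (ys ! k)" if "k < length ys" for k
    using rtrancl_path_nth[OF ys(1) that] .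
  have "length ys \<noteq> 1"
  proof
    assume "length ys = 1"
    then have "ys = [j]" using last by (cases ys) auto
    then show False using step[of 0] by (simp add: Q_def)
  qed
  then have "3 \<le> length (i # ys)" using ne by (cases ys) (auto simp: Suc_le_eq)
  moreover have "{(i # ys) ! k, (i # ys) ! Suc k} \<in> snd G" if "Suc k < length (i # ys)" for k
    using step[of k] that by (auto simp: Q_def)
  moreover have "{last (i # ys), hd (i # ys)} \<in> snd G"
    using edge ne last by (simp add: insert_commute)
  ultimately have "graph_cycle G (i # ys)" using ys(2) unfolding graph_cycle_def by blast
  then show False using G by (auto simp: is_tree_def)
qed


section \<open>Taylor relations and cuts\<close>

lemma lookup_mono_gcd:
  "Poly_Mapping.lookup (mono_gcd s t) x = min (Poly_Mapping.lookup s x) (Poly_Mapping.lookup t x)"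
  by (simp add: mono_gcd_def)

text \<open>Both sides are the exponent vector of \<open>lcm(s, t)\<close>.\<close>

lemma lcm_swap: "(s - mono_gcd s t) + t = (t - mono_gcd s t) + s"
  by (intro poly_mapping_eqI) (simp add: lookup_add lookup_minus lookup_mono_gcd)

lemma mono_deg_diff_gcd:
  "mono_deg (s - mono_gcd s t) + mono_deg (mono_gcd s t) = mono_deg s"
  "mono_deg (t - mono_gcd s t) + mono_deg (mono_gcd s t) = mono_deg t"
proof -
  have "(s - mono_gcd s t) + mono_gcd s t = s" "(t - mono_gcd s t) + mono_gcd s t = t"
    by (intro poly_mapping_eqI; simp add: lookup_add lookup_minus lookup_mono_gcd)+
  then show "mono_deg (s - mono_gcd s t) + mono_deg (mono_gcd s t) = mono_deg s"
    "mono_deg (t - mono_gcd s t) + mono_deg (mono_gcd s t) = mono_deg t"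
    by (simp_all flip: mono_deg_add)
qed

text \<open>The cut functional: \<open>L\<close> is the least common multiple of \<open>u\<^sub>i\<close> and \<open>u\<^sub>j\<close>, and both terms
  of the Taylor relation contribute it, with opposite signs. They cancel unless exactly one of the
  two vertices lies in \<open>C\<close>.\<close>

lemma taylor_relation_weighted_sum:
  fixes C :: "nat set" and u :: "nat \<Rightarrow> 'n::finite \<Rightarrow>\<^sub>0 nat"
  assumes "finite C" "i \<noteq> j"
  defines "L \<equiv> (monomial ((u i - mono_gcd (u i) (u j)) + u j) :: ('n, 'k::field) mpoly)"
  shows "(\<Sum>k\<in>C. taylor_relation u i j k * monomial (u k)) =
    (if j \<in> C then L else 0) - (if i \<in> C then L else 0)"
proof -
  have "(\<Sum>k\<in>C. taylor_relation u i j k * monomial (u k)) =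
      (\<Sum>k\<in>C. (if k = j then L else 0) - (if k = i then L else 0))"
    using assms(2) lcm_swap[of "u i" "u j"]
    by (intro sum.cong) (auto simp: taylor_relation_def L_def monomial_mult)
  then show ?thesis using assms(1) by (simp add: sum_subtractf)
qed

lemma taylor_relation_in_relation_module:
  assumes "i \<in> {1..m+1}" "j \<in> {1..m+1}" "i \<noteq> j"
  shows "taylor_relation u i j \<in> relation_module m u"
  using assms taylor_relation_weighted_sum[of "{1..m+1}" i j u]
  by (auto simp: relation_module_def free_mod_def taylor_relation_def)

lemma weighted_sum_scale_add:
  "(\<Sum>k\<in>C. (vec_scale c v + w) k * f k) = c * (\<Sum>k\<in>C. v k * f k) + (\<Sum>k\<in>C. w k * f k)"
proof -
  have "(\<Sum>k\<in>C. (vec_scale c v + w) k * f k) = (\<Sum>k\<in>C. c * (v k * f k) + w k * f k)"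
    by (rule sum.cong) (simp_all add: vec_scale_def distrib_right mult.assoc)
  then show ?thesis by (simp add: sum.distrib sum_distrib_left)
qed

lemma subspace_relation_module: "vec.subspace (relation_module m u)"
proof -
  have comb: "vec_scale c v + w \<in> relation_module m u"
    if "v \<in> relation_module m u" "w \<in> relation_module m u" for c v w
    using that weighted_sum_scale_add[of c v w "\<lambda>k. monomial (u k)" "{1..m+1}"]
    unfolding relation_module_def free_mod_def by (simp add: vec_scale_def)
  have zero: "0 \<in> relation_module m u" by (simp add: relation_module_def free_mod_def)
  show ?thesis
    unfolding vec.subspace_def using zero comb[of _ _ 1] comb[OF _ zero] by auto
qed

text \<open>For generators of the same degree, \<open>lcm(u\<^sub>i, u\<^sub>j)\<close> exceeds both by the same degree, and
  strictly, since neither generator can divide the other.\<close>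

lemma taylor_relation_homogeneous:
  assumes "mono_deg (u i) = mono_deg (u j)" "u i \<noteq> u j"
  obtains e where "1 \<le> e" "\<And>k. homogeneous e (taylor_relation u i j k)"
proof
  let ?g = "mono_gcd (u i) (u j)"
  let ?e = "mono_deg (u i - ?g)"
  have e: "mono_deg (u j - ?g) = ?e"
    using mono_deg_diff_gcd[where s = "u i" and t = "u j"] assms(1) by linarith
  show "homogeneous ?e (taylor_relation u i j k)" for k
    by (auto simp: taylor_relation_def homogeneous_0 homogeneous_uminus_iff homogeneous_monomial_iff e)
  have "?e \<noteq> 0"
  proof
    assume "?e = 0"
    then have "u i - ?g = 0" "u j - ?g = 0" using e mono_deg_eq_0_iff by metis+
    then show False using assms(2) lcm_swap[of "u i" "u j"] by simp
  qed
  then show "1 \<le> ?e" by simp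
qed

text \<open>Taylor relations are oriented; the rows of a Hilbert-Burch matrix use the orientation from the
  smaller to the larger index.\<close>

definition edge_relation ::
  "(nat \<Rightarrow> 'n::finite \<Rightarrow>\<^sub>0 nat) \<Rightarrow> nat set \<Rightarrow> nat \<Rightarrow> ('n, 'k::field) mpoly" where
  "edge_relation u e = taylor_relation u (Min e) (Max e)"

lemma edge_relation_pair: "i < j \<Longrightarrow> edge_relation u {i, j} = taylor_relation u i j"
  by (simp add: edge_relation_def)

lemma card_2_ordered:
  fixes e :: "nat set"
  assumes "card e = 2"
  obtains i j where "i < j" "e = {i, j}"
proof -
  obtain x y where "e = {x, y}" "x \<noteq> y" using assms by (auto simp: card_2_iff)
  then show ?thesis
    by (cases "x < y") (auto intro: that[of x y] that[of y x] simp: insert_commute)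
qed

lemma simple_graph_edge:
  assumes "simple_graph G" "e \<in> snd G"
  obtains i j where "i < j" "e = {i, j}" "i \<in> fst G" "j \<in> fst G"
proof -
  have e: "e \<subseteq> fst G" "card e = 2" using assms by (auto simp: simple_graph_def)
  show ?thesis by (rule card_2_ordered[OF e(2)]) (use e(1) that in auto)
qed

lemma taylor_relation_support: "i \<noteq> j \<Longrightarrow> {k. taylor_relation u i j k \<noteq> 0} = {i, j}"
  by (auto simp: taylor_relation_def monomial_nonzero)

lemma edge_relation_support:
  assumes "card e = 2"
  shows "{k. edge_relation u e k \<noteq> 0} = e"
  using assms by (elim card_2_ordered) (simp add: edge_relation_pair taylor_relation_support)

lemma inj_on_edge_relation:
  assumes "simple_graph G"
  shows "inj_on (edge_relation u :: nat set \<Rightarrow> nat \<Rightarrow> ('n::finite, 'k::field) mpoly) (snd G)"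
proof (rule inj_onI)
  let ?r = "edge_relation u :: nat set \<Rightarrow> nat \<Rightarrow> ('n, 'k) mpoly"
  fix e e' assume e: "e \<in> snd G" and e': "e' \<in> snd G" and eq: "?r e = ?r e'"
  have "{k. ?r e k \<noteq> 0} = e" "{k. ?r e' k \<noteq> 0} = e'"
    using e e' assms by (simp_all add: edge_relation_support simple_graph_def)
  then show "e = e'" using eq by metis
qed

text \<open>Take for \<open>C\<close> the connected component of \<open>i\<close>. No edge of the graph leaves it, so the cut
  functional of \<open>C\<close> vanishes on the whole span, but it does not vanish on \<open>r\<^sub>i\<^sub>j\<close> if \<open>j\<close> lies outside.\<close>

lemma connected_if_taylor_relation_in_span:
  assumes G: "simple_graph G" and ij: "i \<in> fst G" "j \<in> fst G" "i \<noteq> j"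
    and span: "(taylor_relation u i j :: nat \<Rightarrow> ('n::finite, 'k::field) mpoly)
      \<in> vec.span (edge_relation u ` snd G)"
  shows "(i, j) \<in> {(v, w). {v, w} \<in> snd G}\<^sup>*"
proof (rule ccontr)
  define R where "R = {(v, w). {v, w} \<in> snd G}"
  assume "(i, j) \<notin> {(v, w). {v, w} \<in> snd G}\<^sup>*"
  then have notin: "(i, j) \<notin> R\<^sup>*" by (simp add: R_def)
  define C where "C = {k \<in> fst G. (i, k) \<in> R\<^sup>*}"
  have fin: "finite C" using G by (simp add: C_def simple_graph_def)
  have zero: "(\<Sum>k\<in>C. v k * monomial (u k)) = 0" if "v \<in> vec.span (edge_relation u ` snd G)" for v
    using that
  proof (induction rule: vec.span_induct_alt)
    case base
    show ?case by simp
  next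
    case (step c v w)
    then obtain e where e: "e \<in> snd G" "v = edge_relation u e" by blast
    obtain a b where ab: "a < b" "e = {a, b}" "a \<in> fst G" "b \<in> fst G"
      using simple_graph_edge[OF G e(1)] .
    have "(a, b) \<in> R" "(b, a) \<in> R" using e(1) ab(2) by (auto simp: R_def insert_commute)
    then have "a \<in> C \<longleftrightarrow> b \<in> C" using ab(3,4) by (auto simp: C_def intro: rtrancl_into_rtrancl)
    then have "(\<Sum>k\<in>C. v k * monomial (u k)) = 0"
      using taylor_relation_weighted_sum[OF fin, of a b u] ab e(2) by (simp add: edge_relation_pair)
    then show ?case using step.IH by (simp only: weighted_sum_scale_add) simp
  qed
  have "i \<in> C" "j \<notin> C" using ij notin by (auto simp: C_def)
  then show False
    using zero[OF span] taylor_relation_weighted_sum[OF fin ij(3), of u, where 'k = 'k]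
    by (simp add: monomial_nonzero)
qed

lemma edge_relation_notin_span:
  assumes G: "is_tree G" and e: "e \<in> snd G"
  shows "edge_relation u e \<notin> vec.span (edge_relation u ` (snd G - {e}))"
proof
  assume span: "edge_relation u e \<in> vec.span (edge_relation u ` (snd G - {e}))"
  have simple: "simple_graph G" using G by (simp add: is_tree_def)
  obtain i j where ij: "i < j" "e = {i, j}" "i \<in> fst G" "j \<in> fst G"
    using simple_graph_edge[OF simple e] .
  have "simple_graph (fst G, snd G - {e})" using simple by (auto simp: simple_graph_def)
  then have "(i, j) \<in> {(v, w). {v, w} \<in> snd G - {e}}\<^sup>*"
    using connected_if_taylor_relation_in_span[of "(fst G, snd G - {e})" i j u] ij span
    by (simp add: edge_relation_pair)
  then show False using tree_edge_is_bridge[of G i j] G e ij by simp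
qed


section \<open>Linear syzygies\<close>

text \<open>The scalar action of the field \<open>K\<close> on vectors of polynomials, through constant polynomials. It
  makes dimension arguments over \<open>K\<close> available next to the module structure over the ring.\<close>

definition const_scale ::
  "'k::field \<Rightarrow> (nat \<Rightarrow> ('n, 'k) mpoly) \<Rightarrow> nat \<Rightarrow> ('n, 'k) mpoly" where
  "const_scale c v = vec_scale (Poly_Mapping.single 0 c) v"

interpretation kvec: Vector_Spaces.vector_space const_scale
  by unfold_locales
    (simp_all add: const_scale_def vec_scale_def fun_eq_iff distrib_left distrib_right mult_single
      single_add flip: mult.assoc)

lemma kspan_subset_span: "kvec.span S \<subseteq> vec.span S"
proof (rule kvec.span_minimal)
  show "kvec.subspace (vec.span S)"
    by (auto simp: kvec.subspace_def const_scale_def vec.span_zero vec.span_add vec.span_scale)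
qed (rule vec.span_superset)

definition linear_vector :: "(nat \<Rightarrow> ('n::finite, 'k::field) mpoly) \<Rightarrow> bool" where
  "linear_vector v \<longleftrightarrow> (\<forall>k. homogeneous 1 (v k))"

text \<open>Compare the linear parts in an expression of \<open>x\<close> as a combination of \<open>S\<close>. Since no generator
  has degree 0, a generator that is not linear contributes nothing, and the coefficients of the linear
  ones are reduced to their constant terms.\<close>

lemma linear_vector_in_kspan:
  assumes S: "\<And>r. r \<in> S \<Longrightarrow> \<exists>e\<ge>1. \<forall>k. homogeneous e (r k)"
    and x: "x \<in> vec.span S" "linear_vector x"
  shows "x \<in> kvec.span {r \<in> S. linear_vector r}"
proof -
  have "(\<lambda>k. hom_part 1 (x k)) \<in> kvec.span {r \<in> S. linear_vector r}"
    using x(1)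
  proof (induction rule: vec.span_induct_alt)
    case base
    have "(\<lambda>k. hom_part 1 ((0 :: nat \<Rightarrow> ('a, 'b) mpoly) k)) = 0" by (simp add: fun_eq_iff)
    then show ?case by (simp add: kvec.span_zero)
  next
    case (step c r w)
    obtain e where e: "1 \<le> e" "\<And>k. homogeneous e (r k)" using S[OF step.hyps] by blast
    \<comment> \<open>The scalar by which the summand \<open>c r\<close> contributes to the linear part.\<close>
    let ?c = "if e = 1 then Poly_Mapping.lookup c 0 else 0"
    have const: "hom_part 0 c = Poly_Mapping.single 0 (Poly_Mapping.lookup c 0)"
      using homogeneous_hom_part[of 0 c] unfolding homogeneous_degree_0
      by (simp add: lookup_hom_part mono_deg_eq_0_iff)
    have "(\<lambda>k. hom_part 1 ((vec_scale c r + w) k)) = const_scale ?c r + (\<lambda>k. hom_part 1 (w k))"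
      using e by (auto simp: fun_eq_iff vec_scale_def const_scale_def hom_part_add
          hom_part_mult[OF e(2)] const)
    moreover have "const_scale ?c r \<in> kvec.span {r \<in> S. linear_vector r}"
    proof (cases "e = 1")
      case True
      then have "linear_vector r" using e(2) by (simp add: linear_vector_def)
      then show ?thesis using step.hyps by (intro kvec.span_scale kvec.span_base) auto
    qed (simp add: kvec.span_zero)
    ultimately show ?case using step.IH by (simp add: kvec.span_add)
  qed
  moreover have "(\<lambda>k. hom_part 1 (x k)) = x"
    using x(2) by (simp add: fun_eq_iff linear_vector_def hom_part_homogeneous[of 1])
  ultimately show ?thesis by simp
qed

definition linear_relations ::
  "nat \<Rightarrow> (nat \<Rightarrow> 'n::finite \<Rightarrow>\<^sub>0 nat) \<Rightarrow> (nat \<Rightarrow> ('n, 'k::field) mpoly) set" where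
  "linear_relations m u = {v \<in> relation_module m u. linear_vector v}"

lemma hilbert_burch_rows:
  assumes "hilbert_burch_matrix m u A" "p \<in> {1..m}"
  obtains i j where "1 \<le> i" "i < j" "j \<le> m + 1" "A p = taylor_relation u i j"
  using assms unfolding hilbert_burch_matrix_def by blast

text \<open>The linear rows of a Hilbert-Burch matrix span all linear relations over the field. As the
  linear relations generate the relation module, so do the linear rows, and minimality rules out any
  further row.\<close>

lemma hilbert_burch_linear:
  fixes A :: "nat \<Rightarrow> nat \<Rightarrow> ('n::finite, 'k::field) mpoly"
  assumes deg: "\<And>i. i \<in> {1..m+1} \<Longrightarrow> mono_deg (u i) = d"
    and inj: "inj_on u {1..m+1}"
    and gen: "relation_module m u \<subseteq> vec.span (linear_relations m u :: (nat \<Rightarrow> ('n, 'k) mpoly) set)"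
    and A: "hilbert_burch_matrix m u A"
  shows hilbert_burch_row_linear: "p \<in> {1..m} \<Longrightarrow> A p \<in> linear_relations m u"
    and linear_relations_subset_kspan: "linear_relations m u \<subseteq> kvec.span (A ` {1..m})"
proof -
  have hom: "\<exists>e\<ge>1. \<forall>k. homogeneous e (r k)" if "r \<in> A ` {1..m}" for r
  proof -
    obtain i j where ij: "1 \<le> i" "i < j" "j \<le> m + 1" "r = taylor_relation u i j"
      using \<open>r \<in> A ` {1..m}\<close> hilbert_burch_rows[OF A] by (metis imageE)
    then have "i \<in> {1..m+1}" "j \<in> {1..m+1}" "i \<noteq> j" by auto
    then have "mono_deg (u i) = mono_deg (u j)" "u i \<noteq> u j"
      using deg inj_onD[OF inj] by auto
    then obtain e where "1 \<le> e" "\<And>k. homogeneous e ((taylor_relation u i j :: nat \<Rightarrow> ('n, 'k) mpoly) k)"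
      by (rule taylor_relation_homogeneous) blast
    then show ?thesis using ij(4) by blast
  qed
  have span: "vec.span (A ` {1..m}) = relation_module m u"
    and min: "\<And>p. p \<in> {1..m} \<Longrightarrow> vec.span (A ` ({1..m} - {p})) \<noteq> relation_module m u"
    using A by (auto simp: hilbert_burch_matrix_def)
  let ?L = "{r \<in> A ` {1..m}. linear_vector r}"
  have L: "linear_relations m u \<subseteq> kvec.span ?L"
    using linear_vector_in_kspan[OF hom] span by (auto simp: linear_relations_def)
  then show "linear_relations m u \<subseteq> kvec.span (A ` {1..m})"
    using kvec.span_mono[of ?L "A ` {1..m}"] by blast
  show "A p \<in> linear_relations m u" if p: "p \<in> {1..m}"
  proof (rule ccontr)
    assume "A p \<notin> linear_relations m u"
    moreover have "A p \<in> relation_module m u" using p span vec.span_base[of "A p" "A ` {1..m}"] by auto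
    ultimately have "?L \<subseteq> A ` ({1..m} - {p})" by (auto simp: linear_relations_def)
    moreover have "linear_relations m u \<subseteq> vec.span ?L" using L kspan_subset_span by blast
    ultimately have "linear_relations m u \<subseteq> vec.span (A ` ({1..m} - {p}))"
      using vec.span_mono by blast
    then have "relation_module m u \<subseteq> vec.span (A ` ({1..m} - {p}))"
      using gen vec.span_minimal[OF _ vec.subspace_span] by blast
    moreover have "vec.span (A ` ({1..m} - {p})) \<subseteq> vec.span (A ` {1..m})"
      by (rule vec.span_mono) auto
    ultimately show False using min[OF p] span by blast
  qed
qed


section \<open>Consequences of a linear resolution\<close>

lemma hom_part_below_degree:
  assumes F: "\<And>f. f \<in> F \<Longrightarrow> homogeneous d f" and f: "f \<in> ring_mod.span F" and "e < d"
  shows "hom_part e f = 0"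
  using f
proof (induction rule: ring_mod.span_induct_alt)
  case (step c x y)
  then show ?case using \<open>e < d\<close> hom_part_mult[OF F[OF step.hyps]] by (simp add: hom_part_add)
qed simp

text \<open>No element of the ideal has a component of degree below \<open>d\<close>, so no generator has degree below \<open>d\<close>.
  The elements of \<open>F\<close> equal their degree-\<open>d\<close> parts, to which only the monomials of degree \<open>d\<close>
  contribute. So these monomials generate the ideal, and by minimality there are no others.\<close>

lemma minimal_generators_degree:
  fixes I :: "('n::finite, 'k::field) mpoly set"
  assumes F: "\<And>f. f \<in> F \<Longrightarrow> homogeneous d f" and I: "I = genideal mpoly_ring F"
    and T: "minimal_monomial_generators I T" and t: "t \<in> T"
  shows "mono_deg t = d"
proof -
  have I_F: "I = ring_mod.span F" using I by (simp only: genideal_eq_span)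
  have I_T: "I = ring_mod.span (monomial ` T)"
    and min: "\<And>T'. T' \<subset> T \<Longrightarrow> ring_mod.span (monomial ` T') \<noteq> I"
    using T unfolding minimal_monomial_generators_def genideal_eq_span by blast+
  have ge: "d \<le> mono_deg s" if "s \<in> T" for s
  proof (rule ccontr)
    assume "\<not> d \<le> mono_deg s"
    moreover have "monomial s \<in> ring_mod.span F"
      using that I_F I_T by (metis image_eqI ring_mod.span_base)
    ultimately have "hom_part (mono_deg s) (monomial s :: ('n, 'k) mpoly) = 0"
      using hom_part_below_degree[OF F] by auto
    then show False
      using hom_part_homogeneous[of "mono_deg s" "monomial s :: ('n, 'k) mpoly" "mono_deg s"]
      by (simp add: homogeneous_monomial_iff monomial_nonzero)
  qed
  define T' where "T' = {s \<in> T. mono_deg s = d}"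
  have part: "hom_part d f \<in> ring_mod.span (monomial ` T')" if "f \<in> ring_mod.span (monomial ` T)" for f :: "('n, 'k) mpoly"
    using that
  proof (induction rule: ring_mod.span_induct_alt)
    case base
    show ?case by (simp add: ring_mod.span_zero)
  next
    case (step c x y)
    then obtain s where s: "s \<in> T" "x = monomial s" by blast
    have "hom_part d (c * x) = (if mono_deg s = d then hom_part 0 c * x else 0)"
      using ge[OF s(1)] hom_part_mult[of "mono_deg s" x d c] s(2)
      by (auto simp: homogeneous_monomial_iff)
    moreover have "hom_part 0 c * x \<in> ring_mod.span (monomial ` T')" if "mono_deg s = d"
      using s that by (intro ring_mod.span_scale ring_mod.span_base) (auto simp: T'_def)
    ultimately have "hom_part d (c * x) \<in> ring_mod.span (monomial ` T')"
      by (auto simp: ring_mod.span_zero)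
    then show ?case using step.IH by (simp add: hom_part_add ring_mod.span_add)
  qed
  have "F \<subseteq> ring_mod.span (monomial ` T')"
  proof
    fix f assume f: "f \<in> F"
    then have "f \<in> ring_mod.span (monomial ` T)" using I_F I_T ring_mod.span_base by blast
    from part[OF this] show "f \<in> ring_mod.span (monomial ` T')"
      using hom_part_homogeneous[OF F[OF f], of d] by simp
  qed
  then have "I \<subseteq> ring_mod.span (monomial ` T')"
    unfolding I_F by (rule ring_mod.span_minimal[OF _ ring_mod.subspace_span])
  moreover have "ring_mod.span (monomial ` T') \<subseteq> I"
    unfolding I_T by (rule ring_mod.span_mono) (auto simp: T'_def)
  ultimately have "\<not> T' \<subset> T" using min by blast
  then show ?thesis using t by (auto simp: T'_def)
qed

lemma constant_combination_of_monomials_eq_0: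
  assumes "finite V" "inj_on u V" and const: "\<And>k. k \<in> V \<Longrightarrow> homogeneous 0 (x k)"
    and zero: "(\<Sum>k\<in>V. x k * monomial (u k)) = 0" and k: "k \<in> V"
  shows "x k = 0"
proof -
  have x: "x l * monomial (u l) = Poly_Mapping.single (u l) (Poly_Mapping.lookup (x l) 0)" if "l \<in> V" for l
  proof -
    have "x l = Poly_Mapping.single 0 (Poly_Mapping.lookup (x l) 0)"
      using const[OF that] unfolding homogeneous_degree_0 .
    then have "x l * monomial (u l) = Poly_Mapping.single 0 (Poly_Mapping.lookup (x l) 0) * monomial (u l)"
      by simp
    then show ?thesis by (simp add: monomial_def mult_single)
  qed
  have "0 = Poly_Mapping.lookup (\<Sum>l\<in>V. x l * monomial (u l)) (u k)" by (simp add: zero)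
  also have "\<dots> = (\<Sum>l\<in>V. if l = k then Poly_Mapping.lookup (x l) 0 else 0)"
    unfolding lookup_sum using k inj_onD[OF assms(2)]
    by (intro sum.cong) (auto simp: x lookup_single when_def)
  also have "\<dots> = Poly_Mapping.lookup (x k) 0" using assms(1) k by simp
  finally show ?thesis using const[OF k] by (metis homogeneous_degree_0 single_zero)
qed

text \<open>The degree-\<open>d\<close> part of \<open>v\<^sub>j g\<^sub>j\<close> is a constant multiple of \<open>g\<^sub>j\<close> if \<open>g\<^sub>j\<close> has degree \<open>d\<close>, and it is
  zero if \<open>g\<^sub>j\<close> has larger degree.\<close>

lemma degree_d_generators_constant_combination:
  assumes fin: "finite B" and g: "\<And>j. j \<in> B \<Longrightarrow> homogeneous (a j) (g j)"
    and low: "\<And>j. j \<in> B \<Longrightarrow> a j < d \<Longrightarrow> g j = 0"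
    and f: "homogeneous d f" "f = (\<Sum>j\<in>B. v j * g j)"
  shows "\<exists>p. (\<forall>j. homogeneous 0 (p j)) \<and> f = (\<Sum>j\<in>{j \<in> B. a j = d}. p j * g j)"
proof (intro exI conjI allI)
  show "homogeneous 0 (hom_part 0 (v j))" for j by (rule homogeneous_hom_part)
  have "f = hom_part d f" by (simp add: hom_part_homogeneous[OF f(1)])
  also have "\<dots> = (\<Sum>j\<in>B. hom_part d (v j * g j))" by (simp add: f(2) hom_part_sum)
  also have "\<dots> = (\<Sum>j\<in>B. if a j = d then hom_part 0 (v j) * g j else 0)"
  proof (rule sum.cong)
    fix j assume j: "j \<in> B"
    show "hom_part d (v j * g j) = (if a j = d then hom_part 0 (v j) * g j else 0)"
      using hom_part_mult[OF g[OF j], of d "v j"] low[OF j] by auto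
  qed simp
  also have "\<dots> = (\<Sum>j\<in>{j \<in> B. a j = d}. hom_part 0 (v j) * g j)"
    using fin by (simp add: sum.inter_filter)
  finally show "f = (\<Sum>j\<in>{j \<in> B. a j = d}. hom_part 0 (v j) * g j)" .
qed

text \<open>The resolution describes the relations between its own generators \<open>g\<^sub>j\<close> of the ideal, by a matrix
  \<open>\<phi>\<close> of linear forms, and this has to be transported to the monomials \<open>u\<^sub>i\<close>. The \<open>g\<^sub>j\<close> of
  degree \<open>d\<close> already generate the ideal, as the \<open>u\<^sub>i\<close> do, so the two families are related by constant
  matrices \<open>P\<close> and \<open>Q\<close>. A relation \<open>v\<close>
  between the \<open>u\<^sub>i\<close> gives the relation \<open>v P\<close> between the \<open>g\<^sub>j\<close>, which is a combination of columns of
  \<open>\<phi>\<close>; multiplying by \<open>Q\<close> leads back to \<open>v\<close> because \<open>P Q = 1\<close>, and turns the columns of \<open>\<phi>\<close> into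
  linear relations between the \<open>u\<^sub>i\<close>.\<close>

lemma linear_resolution_linear_syzygies:
  fixes I :: "('n::finite, 'k::field) mpoly set"
  assumes lin: "has_linear_resolution I"
    and min: "minimal_monomial_generators I (u ` {1..m+1})"
    and inj: "inj_on u {1..m+1}"
  obtains d where "\<And>i. i \<in> {1..m+1} \<Longrightarrow> mono_deg (u i) = d"
    and "relation_module m u \<subseteq> vec.span (linear_relations m u :: (nat \<Rightarrow> ('n, 'k) mpoly) set)"
proof -
  obtain d F b a g \<phi> where F: "\<And>f. f \<in> F \<Longrightarrow> homogeneous d f" and I: "I = genideal mpoly_ring F"
    and res: "minimal_graded_free_resolution I b a g \<phi>"
    and lin: "\<And>p q. p < b 0 \<Longrightarrow> q < b 1 \<Longrightarrow> homogeneous 1 (\<phi> 0 p q)"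
    using lin unfolding has_linear_resolution_def by (metis add_0)
  let ?V = "{1..m+1}"
  let ?B = "{..<b 0}"
  have deg: "mono_deg (u i) = d" if "i \<in> ?V" for i
    using minimal_generators_degree[OF F I min] that by blast
  have g: "\<And>j. j \<in> ?B \<Longrightarrow> homogeneous (a 0 j) (g j)"
    and grading: "\<And>p q t. p < b 0 \<Longrightarrow> q < b 1 \<Longrightarrow> t \<in> Poly_Mapping.keys (\<phi> 0 p q) \<Longrightarrow>
      mono_deg t + a 0 p = a 1 q"
    and image: "{\<Sum>j<b 0. v j * g j | v. v \<in> free_mod ?B} = I"
    and kernel: "{v \<in> free_mod ?B. (\<Sum>j<b 0. v j * g j) = 0} =
       mat_vec (b 0) (b 1) (\<phi> 0) ` free_mod {..<b 1}"
    using res unfolding minimal_graded_free_resolution_def by (metis lessThan_iff add_0)+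
  have I_F: "I = ring_mod.span F" using I by (simp only: genideal_eq_span)
  have I_u: "I = ring_mod.span ((\<lambda>i. monomial (u i)) ` ?V)"
    using min unfolding minimal_monomial_generators_def genideal_eq_span image_image by blast
  have g_I: "g j \<in> I" if j: "j \<in> ?B" for j
  proof -
    define v :: "nat \<Rightarrow> ('n, 'k) mpoly" where "v i = (if i = j then 1 else 0)" for i
    have "(\<Sum>i<b 0. v i * g i) = (\<Sum>i<b 0. if i = j then g i else 0)"
      by (rule sum.cong) (auto simp: v_def)
    also have "\<dots> = g j" using j by simp
    finally have "g j = (\<Sum>i<b 0. v i * g i)" by simp
    moreover have "v \<in> free_mod ?B" using j by (auto simp: v_def free_mod_def)
    ultimately show ?thesis unfolding image[symmetric] by blast
  qed
  have low: "g j = 0" if "j \<in> ?B" "a 0 j < d" for j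
    using hom_part_below_degree[OF F _ that(2)] g_I[OF that(1)] hom_part_homogeneous[OF g[OF that(1)], of "a 0 j"]
    by (simp add: I_F)
  \<comment> \<open>All \<open>g\<^sub>j\<close> lie in the ideal, so those of degree below \<open>d\<close> are zero, and those of degree above \<open>d\<close>
    cannot contribute to a form of degree \<open>d\<close>.\<close>
  define J where "J = {j \<in> ?B. a 0 j = d}"
  have "\<exists>p. (\<forall>j. homogeneous 0 (p j)) \<and> monomial (u i) = (\<Sum>j\<in>J. p j * g j)" if i: "i \<in> ?V" for i
  proof -
    have "monomial (u i) \<in> I" unfolding I_u using i by (intro ring_mod.span_base) blast
    then obtain v where "monomial (u i) = (\<Sum>j<b 0. v j * g j)" unfolding image[symmetric] by blast
    moreover have "homogeneous d (monomial (u i) :: ('n, 'k) mpoly)"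
      using deg[OF i] by (simp add: homogeneous_monomial_iff)
    ultimately show ?thesis
      unfolding J_def by (intro degree_d_generators_constant_combination[OF _ g low]) auto
  qed
  then obtain P where P0: "\<And>i j. i \<in> ?V \<Longrightarrow> homogeneous 0 (P i j)"
    and P: "\<And>i. i \<in> ?V \<Longrightarrow> monomial (u i) = (\<Sum>j\<in>J. P i j * g j)" by metis
  have "\<exists>q. (\<forall>k. homogeneous 0 (q k)) \<and> g j = (\<Sum>k\<in>?V. q k * monomial (u k))" if j: "j \<in> J" for j
  proof -
    have "g j \<in> I" using j g_I by (simp add: J_def)
    then obtain c where c: "g j = (\<Sum>k\<in>?V. c k * monomial (u k))"
      unfolding I_u by (elim span_image_eq[rotated]) auto
    have "\<exists>q. (\<forall>k. homogeneous 0 (q k)) \<and> g j = (\<Sum>k\<in>{k \<in> ?V. d = d}. q k * monomial (u k))"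
      by (rule degree_d_generators_constant_combination[OF _ _ _ _ c])
        (use j g[of j] in \<open>auto simp: homogeneous_monomial_iff deg J_def\<close>)
    then show ?thesis by (simp only: refl simp_thms Collect_mem_eq)
  qed
  then obtain Q where Q0: "\<And>j k. j \<in> J \<Longrightarrow> homogeneous 0 (Q j k)"
    and Q: "\<And>j. j \<in> J \<Longrightarrow> g j = (\<Sum>k\<in>?V. Q j k * monomial (u k))" by metis
  have fin_J: "finite J" by (simp add: J_def)
  \<comment> \<open>Distinct monomials are linearly independent over the field, and \<open>P Q\<close> fixes each of them.\<close>
  have PQ: "(\<Sum>j\<in>J. P i j * Q j k) = (if k = i then 1 else 0)" if i: "i \<in> ?V" and k: "k \<in> ?V" for i k
  proof -
    define x where "x k = (\<Sum>j\<in>J. P i j * Q j k) - (if k = i then 1 else 0)" for k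
    have "homogeneous 0 (\<Sum>j\<in>J. P i j * Q j k)" for k
      using homogeneous_mult[OF P0[OF i] Q0] by (intro homogeneous_sum) simp
    moreover have "homogeneous 0 (- (if k = i then 1 else 0) :: ('n, 'k) mpoly)" for k
      by (auto simp: homogeneous_def mono_deg_eq_0_iff keys_one split: if_splits)
    ultimately have const: "homogeneous 0 (x k)" for k
      unfolding x_def diff_conv_add_uminus by (rule homogeneous_add)
    have "(\<Sum>k\<in>?V. (\<Sum>j\<in>J. P i j * Q j k) * monomial (u k)) =
        (\<Sum>j\<in>J. P i j * (\<Sum>k\<in>?V. Q j k * monomial (u k)))"
      by (simp only: sum_distrib_left sum_distrib_right mult.assoc) (rule sum.swap)
    also have "\<dots> = monomial (u i)" using P[OF i] Q by simp
    also have "\<dots> = (\<Sum>k\<in>?V. (if k = i then 1 else 0) * monomial (u k))"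
    proof -
      have "(\<Sum>k\<in>?V. (if k = i then 1 else 0) * monomial (u k)) =
          (\<Sum>k\<in>?V. if k = i then monomial (u k) :: ('n, 'k) mpoly else 0)"
        by (rule sum.cong) auto
      also have "\<dots> = monomial (u i)" by (subst sum.delta) (use i in auto)
      finally show ?thesis by simp
    qed
    finally have "(\<Sum>k\<in>?V. x k * monomial (u k)) = 0"
      by (simp only: x_def left_diff_distrib sum_subtractf) simp
    then have "x k = 0"
      by (intro constant_combination_of_monomials_eq_0[OF _ inj const _ k]) auto
    then show ?thesis by (simp add: x_def)
  qed
  \<comment> \<open>The column \<open>q\<close> of \<open>\<phi>\<close>, rewritten in terms of the monomials.\<close>
  define z where "z q k = (if k \<in> ?V then \<Sum>j\<in>J. \<phi> 0 j q * Q j k else 0)" for q k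
  \<comment> \<open>Only the rows in \<open>J\<close> enter here, but the grading makes a column that is nonzero in some row of
    \<open>J\<close> vanish in all rows outside \<open>J\<close>, so the sum is the full relation given by that column.\<close>
  have column: "(\<Sum>j\<in>J. \<phi> 0 j q * g j) = 0" if q: "q < b 1" for q
  proof (cases "\<forall>j\<in>J. \<phi> 0 j q = 0")
    case False
    then obtain j t where j: "j \<in> J" "t \<in> Poly_Mapping.keys (\<phi> 0 j q)" by (metis all_not_in_conv keys_eq_empty)
    moreover have "mono_deg t = 1" using lin[of j q] j q by (auto simp: J_def homogeneous_def)
    ultimately have a1: "a 1 q = d + 1" using grading[of j q t] q by (auto simp: J_def)
    have outside: "\<phi> 0 i q = 0" if "i \<in> ?B - J" for i
    proof (rule ccontr)
      assume "\<phi> 0 i q \<noteq> 0"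
      then obtain s where s: "s \<in> Poly_Mapping.keys (\<phi> 0 i q)" by (metis all_not_in_conv keys_eq_empty)
      moreover have "mono_deg s = 1" using lin[of i q] s that q by (auto simp: homogeneous_def)
      ultimately show False using grading[of i q s] q that a1 by (auto simp: J_def)
    qed
    define v :: "nat \<Rightarrow> ('n, 'k) mpoly" where "v i = (if i = q then 1 else 0)" for i
    have mv: "mat_vec (b 0) (b 1) (\<phi> 0) v i = \<phi> 0 i q" if "i < b 0" for i
    proof -
      have "mat_vec (b 0) (b 1) (\<phi> 0) v i = (\<Sum>j<b 1. if j = q then \<phi> 0 i j else 0)"
        using that unfolding mat_vec_def v_def by (simp only: if_True, intro sum.cong) auto
      then show ?thesis using q by simp
    qed
    have "v \<in> free_mod {..<b 1}" using q by (auto simp: v_def free_mod_def)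
    then have "(\<Sum>j<b 0. mat_vec (b 0) (b 1) (\<phi> 0) v j * g j) = 0" using kernel by blast
    moreover have "(\<Sum>j<b 0. mat_vec (b 0) (b 1) (\<phi> 0) v j * g j) = (\<Sum>j<b 0. \<phi> 0 j q * g j)"
      by (rule sum.cong) (use mv in auto)
    ultimately have "(\<Sum>j<b 0. \<phi> 0 j q * g j) = 0" by simp
    moreover have "(\<Sum>j\<in>J. \<phi> 0 j q * g j) = (\<Sum>j<b 0. \<phi> 0 j q * g j)"
      by (rule sum.mono_neutral_left) (auto simp: J_def outside[unfolded J_def])
    ultimately show ?thesis by simp
  qed auto
  have z_lin: "z q \<in> linear_relations m u" if q: "q < b 1" for q
  proof -
    have "(\<Sum>k\<in>?V. z q k * monomial (u k)) = (\<Sum>k\<in>?V. (\<Sum>j\<in>J. \<phi> 0 j q * Q j k) * monomial (u k))"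
      by (rule sum.cong) (auto simp: z_def)
    also have "\<dots> = (\<Sum>j\<in>J. \<phi> 0 j q * (\<Sum>k\<in>?V. Q j k * monomial (u k)))"
      by (simp only: sum_distrib_left sum_distrib_right mult.assoc) (rule sum.swap)
    also have "\<dots> = 0" using column[OF q] Q by simp
    finally have "z q \<in> relation_module m u"
      by (simp add: relation_module_def free_mod_def z_def)
    moreover have "homogeneous 1 (z q k)" for k
    proof -
      have "homogeneous 1 (\<phi> 0 j q * Q j k)" if "j \<in> J" for j
        using homogeneous_mult[OF lin[of j q] Q0[OF that, of k]] that q by (simp add: J_def)
      then show ?thesis by (auto simp: z_def homogeneous_0 intro: homogeneous_sum)
    qed
    ultimately show ?thesis by (simp add: linear_relations_def linear_vector_def)
  qed
  have "v \<in> vec.span (linear_relations m u)" if v: "v \<in> relation_module m u" for v :: "nat \<Rightarrow> ('n, 'k) mpoly"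
  proof -
    \<comment> \<open>The vector \<open>v P\<close>, a relation between the \<open>g\<^sub>j\<close>.\<close>
    define w where "w j = (if j \<in> J then \<Sum>i\<in>?V. v i * P i j else 0)" for j
    have "(\<Sum>j<b 0. w j * g j) = (\<Sum>j\<in>J. (\<Sum>i\<in>?V. v i * P i j) * g j)"
      unfolding w_def by (rule sum.mono_neutral_cong_right) (auto simp: J_def)
    also have "\<dots> = (\<Sum>i\<in>?V. v i * (\<Sum>j\<in>J. P i j * g j))"
      by (simp only: sum_distrib_left sum_distrib_right mult.assoc) (rule sum.swap)
    also have "\<dots> = (\<Sum>i\<in>?V. v i * monomial (u i))" using P by simp
    also have "\<dots> = 0" using v by (simp add: relation_module_def)
    finally have "w \<in> {v \<in> free_mod ?B. (\<Sum>j<b 0. v j * g j) = 0}"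
      by (auto simp: free_mod_def w_def J_def)
    then obtain c where c: "w = mat_vec (b 0) (b 1) (\<phi> 0) c" unfolding kernel by blast
    have "v k = (\<Sum>q<b 1. vec_scale (c q) (z q) k)" for k
    proof (cases "k \<in> ?V")
      case True
      have "v k = (\<Sum>i\<in>?V. if i = k then v i else 0)" by (subst sum.delta) (use True in auto)
      also have "\<dots> = (\<Sum>i\<in>?V. v i * (\<Sum>j\<in>J. P i j * Q j k))"
        by (rule sum.cong) (use PQ[OF _ True] in auto)
      also have "\<dots> = (\<Sum>j\<in>J. (\<Sum>i\<in>?V. v i * P i j) * Q j k)"
        by (simp only: sum_distrib_left sum_distrib_right mult.assoc) (rule sum.swap)
      also have "\<dots> = (\<Sum>j\<in>J. (\<Sum>q<b 1. \<phi> 0 j q * c q) * Q j k)"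
      proof (rule sum.cong)
        fix j assume j: "j \<in> J"
        then have "(\<Sum>i\<in>?V. v i * P i j) = w j" by (simp add: w_def)
        also have "\<dots> = (\<Sum>q<b 1. \<phi> 0 j q * c q)" using j by (simp add: c mat_vec_def J_def)
        finally show "(\<Sum>i\<in>?V. v i * P i j) * Q j k = (\<Sum>q<b 1. \<phi> 0 j q * c q) * Q j k" by simp
      qed simp
      also have "\<dots> = (\<Sum>q<b 1. c q * (\<Sum>j\<in>J. \<phi> 0 j q * Q j k))"
        by (simp only: sum_distrib_left sum_distrib_right mult.assoc mult.left_commute) (rule sum.swap)
      also have "\<dots> = (\<Sum>q<b 1. vec_scale (c q) (z q) k)"
        using True by (simp add: vec_scale_def z_def)
      finally show ?thesis .
    next
      case False
      then have "v k = 0" using v by (simp add: relation_module_def free_mod_def)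
      moreover have "z q k = 0" for q unfolding z_def using False by (rule if_not_P)
      ultimately show ?thesis by (simp add: vec_scale_def)
    qed
    moreover have "(\<Sum>q\<in>A. h q) k = (\<Sum>q\<in>A. h q k)"
      for A :: "nat set" and h :: "nat \<Rightarrow> nat \<Rightarrow> ('n, 'k) mpoly" and k
      by (induction A rule: infinite_finite_induct) auto
    ultimately have "v = (\<Sum>q<b 1. vec_scale (c q) (z q))" by (simp add: fun_eq_iff)
    then show ?thesis
      using z_lin by (auto intro!: vec.span_sum vec.span_scale intro: vec.span_base)
  qed
  then show ?thesis using that deg by blast
qed


section \<open>Relation trees are the spanning trees of the Taylor graph\<close>

text \<open>Every \<open>r\<^sub>i\<^sub>j\<close> is a relation, hence in the span of the rows, so the graph of the rows is connected;
  different edges belong to different rows, so there are at most \<open>m\<close> of them.\<close>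

lemma matrix_graph_is_tree:
  fixes A :: "nat \<Rightarrow> nat \<Rightarrow> ('n::finite, 'k::field) mpoly"
  assumes A: "hilbert_burch_matrix m u A"
  shows "is_tree (matrix_graph m u A)"
proof (rule is_treeI_card)
  let ?G = "matrix_graph m u A"
  have V: "fst ?G = {1..m+1}" by (simp add: matrix_graph_def)
  show simple: "simple_graph ?G"
    by (auto simp: simple_graph_def matrix_graph_def)
  have rows: "A ` {1..m} \<subseteq> edge_relation u ` snd ?G"
  proof
    fix r assume "r \<in> A ` {1..m}"
    then obtain p where p: "p \<in> {1..m}" "r = A p" by blast
    obtain i j where ij: "1 \<le> i" "i < j" "j \<le> m + 1" "A p = taylor_relation u i j"
      using hilbert_burch_rows[OF A p(1)] .
    then have "{i, j} \<in> snd ?G" using p(1) unfolding matrix_graph_def snd_conv by blast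
    moreover have "r = edge_relation u {i, j}" using ij p(2) by (simp add: edge_relation_pair)
    ultimately show "r \<in> edge_relation u ` snd ?G" by blast
  qed
  have "(i, j) \<in> {(v, w). {v, w} \<in> snd ?G}\<^sup>*" if "i \<in> fst ?G" "j \<in> fst ?G" for i j
  proof (cases "i = j")
    case False
    have "(taylor_relation u i j :: nat \<Rightarrow> ('n, 'k) mpoly) \<in> relation_module m u"
      using that False unfolding V by (rule taylor_relation_in_relation_module)
    also have "\<dots> = vec.span (A ` {1..m})" using A by (simp add: hilbert_burch_matrix_def)
    also have "\<dots> \<subseteq> vec.span (edge_relation u ` snd ?G)" using rows by (rule vec.span_mono)
    finally show ?thesis using connected_if_taylor_relation_in_span[OF simple that False] by blast
  qed simp
  then show "graph_connected ?G" by (auto simp: graph_connected_def V)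
  have "snd ?G \<subseteq> (\<lambda>p. {k. A p k \<noteq> 0}) ` {1..m}"
  proof
    fix e assume "e \<in> snd ?G"
    then obtain i j p where ij: "i < j" "e = {i, j}" "p \<in> {1..m}" "A p = taylor_relation u i j"
      by (auto simp: matrix_graph_def)
    then have "e = {k. A p k \<noteq> 0}" by (simp add: taylor_relation_support)
    then show "e \<in> (\<lambda>p. {k. A p k \<noteq> 0}) ` {1..m}" using ij(3) by blast
  qed
  then have "card (snd ?G) \<le> m" by (metis card_atLeastAtMost diff_Suc_1 finite_atLeastAtMost surj_card_le)
  then show "card (snd ?G) < card (fst ?G)" by (simp add: V)
qed

text \<open>The set \<open>S\<close> bounds the dimension of the space of linear relations by \<open>m\<close>. The relations of the
  tree are \<open>m\<close> independent elements of this space, so they span it.\<close>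

lemma hilbert_burch_of_tree:
  fixes \<Gamma> :: graph and S :: "(nat \<Rightarrow> ('n::finite, 'k::field) mpoly) set"
  assumes \<Gamma>: "is_tree \<Gamma>" "fst \<Gamma> = {1..m+1}"
    and fin: "finite S" "card S \<le> m"
    and lin: "edge_relation u ` snd \<Gamma> \<subseteq> (linear_relations m u :: (nat \<Rightarrow> ('n, 'k) mpoly) set)"
    and S: "linear_relations m u \<subseteq> kvec.span S"
    and gen: "relation_module m u \<subseteq> vec.span (linear_relations m u :: (nat \<Rightarrow> ('n, 'k) mpoly) set)"
  obtains A :: "nat \<Rightarrow> nat \<Rightarrow> ('n, 'k) mpoly"
  where "hilbert_burch_matrix m u A" "matrix_graph m u A = \<Gamma>"
proof -
  let ?r = "edge_relation u :: nat set \<Rightarrow> nat \<Rightarrow> ('n, 'k) mpoly"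
  have simple: "simple_graph \<Gamma>" using \<Gamma> by (simp add: is_tree_def)
  have inj: "inj_on ?r (snd \<Gamma>)" by (rule inj_on_edge_relation[OF simple])
  have remove: "?r ` snd \<Gamma> - {?r e} = ?r ` (snd \<Gamma> - {e})" if "e \<in> snd \<Gamma>" for e
    using inj that by (auto dest: inj_onD)
  have indep: "kvec.independent (?r ` snd \<Gamma>)"
    unfolding kvec.dependent_def
  proof
    assume "\<exists>a\<in>?r ` snd \<Gamma>. a \<in> kvec.span (?r ` snd \<Gamma> - {a})"
    then obtain e where e: "e \<in> snd \<Gamma>" "?r e \<in> kvec.span (?r ` (snd \<Gamma> - {e}))"
      using remove by auto
    then show False using edge_relation_notin_span[OF \<Gamma>(1) e(1), where u = u and 'b = 'k] kspan_subset_span by blast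
  qed
  have "finite (?r ` snd \<Gamma>) \<and> card (?r ` snd \<Gamma>) \<le> card S"
    using lin S by (intro kvec.independent_span_bound[OF fin(1) indep]) blast
  then have "finite (snd \<Gamma>)" "card (snd \<Gamma>) \<le> m"
    using fin(2) inj finite_image_iff[OF inj] card_image[OF inj] by simp_all
  moreover have "m \<le> card (snd \<Gamma>)"
    using card_vertices_le[OF simple] \<Gamma> by (simp add: is_tree_def)
  ultimately have card: "finite (snd \<Gamma>)" "card (snd \<Gamma>) = m" by auto
  \<comment> \<open>Otherwise the relations of the tree could be extended to \<open>m + 1\<close> independent elements.\<close>
  have "linear_relations m u \<subseteq> kvec.span (?r ` snd \<Gamma>)"
  proof (rule ccontr)
    assume "\<not> linear_relations m u \<subseteq> kvec.span (?r ` snd \<Gamma>)"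
    then obtain x where x: "x \<in> linear_relations m u" "x \<notin> kvec.span (?r ` snd \<Gamma>)" by blast
    then have "kvec.independent (insert x (?r ` snd \<Gamma>))"
      using indep by (simp add: kvec.independent_insertI)
    then have "card (insert x (?r ` snd \<Gamma>)) \<le> card S"
      using kvec.independent_span_bound[OF fin(1)] x(1) lin S by blast
    moreover have "x \<notin> ?r ` snd \<Gamma>" using x(2) kvec.span_base by blast
    ultimately show False using card fin(2) card_image[OF inj] by simp
  qed
  then have "relation_module m u \<subseteq> vec.span (?r ` snd \<Gamma>)"
    using gen kspan_subset_span vec.span_minimal[OF _ vec.subspace_span] by blast
  moreover have "vec.span (?r ` snd \<Gamma>) \<subseteq> relation_module m u"
    using lin by (intro vec.span_minimal[OF _ subspace_relation_module]) (auto simp: linear_relations_def)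
  ultimately have span: "vec.span (?r ` snd \<Gamma>) = relation_module m u" by blast
  obtain h where h: "bij_betw h {1..m} (snd \<Gamma>)"
    using ex_bij_betw_nat_finite_1[OF card(1)] card(2) by auto
  define A where "A p = ?r (h p)" for p
  have img: "A ` {1..m} = ?r ` snd \<Gamma>"
    using bij_betw_imp_surj_on[OF h] unfolding A_def by (metis image_image)
  have edge: "\<exists>i j. 1 \<le> i \<and> i < j \<and> j \<le> m + 1 \<and> e = {i, j}" if e: "e \<in> snd \<Gamma>" for e
  proof -
    obtain i j where "i < j" "e = {i, j}" "i \<in> fst \<Gamma>" "j \<in> fst \<Gamma>" by (rule simple_graph_edge[OF simple e])
    then show ?thesis using \<Gamma>(2) by auto
  qed
  have "hilbert_burch_matrix m u A"
    unfolding hilbert_burch_matrix_def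
  proof (intro conjI ballI)
    fix p assume p: "p \<in> {1..m}"
    then have hp: "h p \<in> snd \<Gamma>" using h by (auto simp: bij_betw_def)
    show "\<exists>i j. 1 \<le> i \<and> i < j \<and> j \<le> m + 1 \<and> A p = taylor_relation u i j"
      using edge[OF hp] unfolding A_def by (metis edge_relation_pair)
    have "h ` ({1..m} - {p}) = snd \<Gamma> - {h p}"
      using h p by (auto simp: bij_betw_def dest: inj_onD)
    then have "A ` ({1..m} - {p}) = ?r ` (snd \<Gamma> - {h p})" by (auto simp: A_def image_image[symmetric])
    then have "A p \<notin> vec.span (A ` ({1..m} - {p}))"
      using edge_relation_notin_span[OF \<Gamma>(1) hp, where u = u and 'b = 'k] by (simp add: A_def)
    moreover have "A p \<in> relation_module m u"
      unfolding span[symmetric] img[symmetric] using p by (intro vec.span_base) blast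
    ultimately show "vec.span (A ` ({1..m} - {p})) \<noteq> relation_module m u" by blast
  qed (simp only: img span)
  moreover have "matrix_graph m u A = \<Gamma>"
  proof (rule prod_eqI)
    show "snd (matrix_graph m u A) = snd \<Gamma>"
    proof
      show "snd (matrix_graph m u A) \<subseteq> snd \<Gamma>"
      proof
        fix e assume "e \<in> snd (matrix_graph m u A)"
        then obtain i j p where ij: "i < j" "e = {i, j}" "p \<in> {1..m}" "A p = taylor_relation u i j"
          by (auto simp: matrix_graph_def)
        have hp: "h p \<in> snd \<Gamma>" using ij(3) h by (auto simp: bij_betw_def)
        then have "{k. ?r (h p) k \<noteq> 0} = h p" using simple by (simp add: edge_relation_support simple_graph_def)
        moreover have "{k. A p k \<noteq> 0} = e" using ij by (simp add: taylor_relation_support)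
        ultimately show "e \<in> snd \<Gamma>" using hp by (simp add: A_def)
      qed
      show "snd \<Gamma> \<subseteq> snd (matrix_graph m u A)"
      proof
        fix e assume e: "e \<in> snd \<Gamma>"
        then obtain p where p: "p \<in> {1..m}" "e = h p" using bij_betw_imp_surj_on[OF h] by blast
        obtain i j where "1 \<le> i" "i < j" "j \<le> m + 1" "e = {i, j}" using edge[OF e] by blast
        moreover from this have "A p = taylor_relation u i j"
          using p(2) by (simp add: A_def edge_relation_pair)
        ultimately show "e \<in> snd (matrix_graph m u A)"
          using p(1) unfolding matrix_graph_def snd_conv by blast
      qed
    qed
  qed (simp add: matrix_graph_def \<Gamma>(2))
  ultimately show ?thesis using that by blast
qed

theorem theorem2p5:
  fixes I :: "('n::{finite,linorder}, 'k::field) mpoly set"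
    and m :: nat
    and u :: "nat \<Rightarrow> 'n \<Rightarrow>\<^sub>0 nat"
  assumes "monomial_ideal I"
    and "cohen_macaulay_ring (FactRing mpoly_ring I)"
    and "height mpoly_ring I = 2"
    and "has_linear_resolution I"
    and "minimal_monomial_generators I (u ` {1..m+1})"
    and "inj_on u {1..m+1}"
  shows "relation_trees TYPE('k) m u = spanning_trees (taylor_graph TYPE('k) m u)"
proof
  show "relation_trees TYPE('k) m u \<subseteq> spanning_trees (taylor_graph TYPE('k) m u)"
  proof
    fix \<Gamma> assume \<Gamma>: "\<Gamma> \<in> relation_trees TYPE('k) m u"
    then obtain A :: "nat \<Rightarrow> nat \<Rightarrow> ('n, 'k) mpoly"
      where A: "hilbert_burch_matrix m u A" "\<Gamma> = matrix_graph m u A"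
      by (auto simp: relation_trees_def)
    have "is_tree \<Gamma>" "fst \<Gamma> = {1..m+1}"
      unfolding A(2) by (rule matrix_graph_is_tree[OF A(1)]) (simp add: matrix_graph_def)
    then show "\<Gamma> \<in> spanning_trees (taylor_graph TYPE('k) m u)"
      using \<Gamma> by (auto simp: spanning_trees_def taylor_graph_def)
  qed
next
  obtain d where deg: "\<And>i. i \<in> {1..m+1} \<Longrightarrow> mono_deg (u i) = d"
    and gen: "relation_module m u \<subseteq> vec.span (linear_relations m u :: (nat \<Rightarrow> ('n, 'k) mpoly) set)"
    using linear_resolution_linear_syzygies[OF assms(4-6)] by blast
  show "spanning_trees (taylor_graph TYPE('k) m u) \<subseteq> relation_trees TYPE('k) m u"
  proof
    fix \<Gamma> assume "\<Gamma> \<in> spanning_trees (taylor_graph TYPE('k) m u)"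
    then have \<Gamma>: "is_tree \<Gamma>" "fst \<Gamma> = {1..m+1}"
      and edges: "snd \<Gamma> \<subseteq> (\<Union>\<Gamma>\<in>relation_trees TYPE('k) m u. snd \<Gamma>)"
      by (auto simp: spanning_trees_def taylor_graph_def)
    have edge: "\<exists>A. hilbert_burch_matrix m u A \<and> (edge_relation u e :: nat \<Rightarrow> ('n, 'k) mpoly) \<in> A ` {1..m}"
      if e: "e \<in> snd \<Gamma>" for e
    proof -
      obtain A :: "nat \<Rightarrow> nat \<Rightarrow> ('n, 'k) mpoly"
        where A: "hilbert_burch_matrix m u A" "e \<in> snd (matrix_graph m u A)"
        using e edges by (auto simp: relation_trees_def)
      then obtain i j p where "i < j" "e = {i, j}" "p \<in> {1..m}" "A p = taylor_relation u i j"
        by (auto simp: matrix_graph_def)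
      then show ?thesis using A(1) by (metis edge_relation_pair image_eqI)
    qed
    have lin: "edge_relation u ` snd \<Gamma> \<subseteq> (linear_relations m u :: (nat \<Rightarrow> ('n, 'k) mpoly) set)"
    proof (rule image_subsetI)
      fix e assume "e \<in> snd \<Gamma>"
      then obtain A p where A: "hilbert_burch_matrix m u A" and p: "p \<in> {1..m}"
        and e: "(edge_relation u e :: nat \<Rightarrow> ('n, 'k) mpoly) = A p"
        using edge by blast
      show "(edge_relation u e :: nat \<Rightarrow> ('n, 'k) mpoly) \<in> linear_relations m u"
        unfolding e by (rule hilbert_burch_row_linear[OF deg assms(6) gen A p])
    qed
    \<comment> \<open>An edge of the tree supplies a Hilbert-Burch matrix, whose rows bound the dimension; a tree
      without edges has one vertex, and then there are no relations other than zero.\<close>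
    have "\<exists>S :: (nat \<Rightarrow> ('n, 'k) mpoly) set. finite S \<and> card S \<le> m \<and> linear_relations m u \<subseteq> kvec.span S"
    proof (cases "snd \<Gamma> = {}")
      case False
      then obtain A :: "nat \<Rightarrow> nat \<Rightarrow> ('n, 'k) mpoly" where A: "hilbert_burch_matrix m u A" using edge by blast
      have "linear_relations m u \<subseteq> kvec.span (A ` {1..m})"
        by (rule linear_relations_subset_kspan[OF deg assms(6) gen A])
      moreover have "card (A ` {1..m}) \<le> m" using card_image_le[of "{1..m}" A] by simp
      ultimately show ?thesis by blast
    next
      case True
      then have "m = 0" using card_vertices_le[of \<Gamma>] \<Gamma> by (simp add: is_tree_def)
      have "v = 0" if "v \<in> linear_relations m u" for v :: "nat \<Rightarrow> ('n, 'k) mpoly"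
      proof -
        have "v 1 * monomial (u 1) = 0" "\<And>i. i \<noteq> 1 \<Longrightarrow> v i = 0"
          using that \<open>m = 0\<close> by (auto simp: linear_relations_def relation_module_def free_mod_def)
        moreover from this have "v 1 = 0" by (simp add: monomial_nonzero)
        ultimately show ?thesis by (metis ext zero_fun_apply)
      qed
      then show ?thesis using \<open>m = 0\<close> kvec.span_zero by (intro exI[of _ "{}"]) auto
    qed
    then obtain S :: "(nat \<Rightarrow> ('n, 'k) mpoly) set"
      where "finite S" "card S \<le> m" "linear_relations m u \<subseteq> kvec.span S" by blast
    then obtain A :: "nat \<Rightarrow> nat \<Rightarrow> ('n, 'k) mpoly"
      where "hilbert_burch_matrix m u A" "matrix_graph m u A = \<Gamma>"
      by (rule hilbert_burch_of_tree[OF \<Gamma> _ _ lin _ gen])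
    then show "\<Gamma> \<in> relation_trees TYPE('k) m u" by (auto simp: relation_trees_def)
  qed
qed

end
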